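(* There exist universal constants $c,c'>0$ such that the following holds. For all $p\in[1,2)$, if $d,n\in\mathbb N$, $\xi\in(0,1/e)$ and $\alpha>0$ satisfy $$\frac{c}{\sqrt n}\le \alpha\le \min\left\{c\sqrt{\frac{d}{n^2\log(1/\xi)}},\ \frac16\right\},$$ then there exists an $\ell_p$ SCO problem $\mathcal P\in\mathcal L_p^d$ such that every $\alpha$-learner $\mathcal A_n$ for $\mathcal P$ (using $n$ samples) is $(\xi,m)$-traceable for some $m\ge c'\alpha^{-2}$ (i.e. $m\in\Omega(\alpha^{-2})$).
   Context: $\mathcal M_1(\mathcal R)$ denotes the set of probability measures on a measurable space $\mathcal R$, and $\mathcal B_p(r)=\{\theta\in\mathbb R^d:\|\theta\|_p\le r\}$. An SCO problem in dimension $d$ is a triple $\mathcal P=(\Theta,\mathcal Z,f)$ with $\mathcal Z$ a measurable data space, $\Theta\subset\mathbb R^d$ convex, and $f:\Theta\times\mathcal Z\to\mathbb R$ with $f(\cdot,z)$ convex for every $z\in\mathcal Z$. For $\mathcal D\in\mathcal M_1(\mathcal Z)$, let $F_{\mathcal D}(\theta)=\mathbb E_{Z\sim\mathcal D}[f(\theta,Z)]$. A (randomized) learning algorithm is a map $\mathcal A_n:\mathcal Z^n\to\mathcal M_1(\Theta)$; it is an $\alpha$-learner for $\mathcal P$ if for every $\mathcal D\in\mathcal M_1(\mathcal Z)$, $\mathbb E_{S_n\sim\mathcal D^{\otimes n},\hat\theta\sim\mathcal A_n(S_n)}[F_{\mathcal D}(\hat\theta)]-\inf_{\theta\in\Theta}F_{\mathcal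 D}(\theta)\le\alpha$. $\mathcal L_p^d$ ($\ell_p$ SCO problems) is the set of SCO problems $(\Theta,\mathcal Z,f)$ in dimension $d$ with $\Theta\subset\mathcal B_p(1)$ and $|f(\theta_1,z)-f(\theta_2,z)|\le\|\theta_1-\theta_2\|_p$ for all $\theta_1,\theta_2\in\Theta$, $z\in\mathcal Z$. Tracing: a tracer is a pair $(\phi,\mathcal D)$ with $\phi:\Theta\times\mathcal Z\to\mathbb R$ measurable and $\mathcal D\in\mathcal M_1(\mathcal Z)$. An algorithm $\mathcal A_n$ is $(\xi,m)$-traceable ($\xi\in(0,1)$, $m$ a real number) if there exist a tracer $(\phi,\mathcal D)$ and $\lambda\in\mathbb R$ such that, if $(Z_0,Z_1,\dots,Z_n)\sim\mathcal D^{\otimes(n+1)}$ and $\hat\theta\sim\mathcal A_n(Z_1,\dots,Z_n)$ (independently of $Z_0$ given the sample), then (i) $\Pr(\phi(\hat\theta,Z_0)\ge\lambda)\le\xi$, and (ii) $\mathbb E\big[|\{i\in[n]:\phi(\hat\theta,Z_i)\ge\lambda\}|\big]\ge m$. *)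

theory Defs
  imports "HOL-Probability.Probability"
begin

text \<open>
  The dimension \<open>d\<close> has to range inside formulas (the constants of the theorem must not
  depend on it), so \<open>\<real>\<^sup>d\<close> is represented by the extensional functions
  \<open>{..<d} \<rightarrow>\<^sub>E UNIV\<close>, which is the space of the product measure space
  \<open>Pi\<^sub>M {..<d} (\<lambda>_. borel)\<close>, and not by a type.
\<close>

type_synonym rvec = "nat \<Rightarrow> real"

abbreviation Rd :: "nat \<Rightarrow> rvec measure" where
  "Rd d \<equiv> Pi\<^sub>M {..<d} (\<lambda>_. borel)"

definition lp_norm :: "real \<Rightarrow> nat \<Rightarrow> rvec \<Rightarrow> real" where
  "lp_norm p d x = (\<Sum>i<d. \<bar>x i\<bar> powr p) powr (1 / p)"

definition lp_ball :: "real \<Rightarrow> nat \<Rightarrow> real \<Rightarrow> rvec set" where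
  "lp_ball p d r = {\<theta> \<in> space (Rd d). lp_norm p d \<theta> \<le> r}"

definition comb :: "nat \<Rightarrow> real \<Rightarrow> rvec \<Rightarrow> rvec \<Rightarrow> rvec" where
  "comb d t x y = (\<lambda>i\<in>{..<d}. (1 - t) * x i + t * y i)"

definition convex_Rd :: "nat \<Rightarrow> rvec set \<Rightarrow> bool" where
  "convex_Rd d \<Theta> \<longleftrightarrow> (\<forall>x\<in>\<Theta>. \<forall>y\<in>\<Theta>. \<forall>t\<in>{0..1}. comb d t x y \<in> \<Theta>)"

definition convex_on_Rd :: "nat \<Rightarrow> rvec set \<Rightarrow> (rvec \<Rightarrow> real) \<Rightarrow> bool" where
  "convex_on_Rd d \<Theta> g \<longleftrightarrow> convex_Rd d \<Theta> \<and>
     (\<forall>x\<in>\<Theta>. \<forall>y\<in>\<Theta>. \<forall>t\<in>{0..1}. g (comb d t x y) \<le> (1 - t) * g x + t * g y)"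

text \<open>\<open>\<M>\<^sub>1(\<R>)\<close>.\<close>

abbreviation prob_measures :: "'a measure \<Rightarrow> 'a measure set" where
  "prob_measures R \<equiv> space (prob_algebra R)"

text \<open>\<open>\<Theta>\<close> as a measurable space, with the trace of the Borel sets of \<open>\<real>\<^sup>d\<close>.\<close>

definition param_space :: "nat \<Rightarrow> rvec set \<Rightarrow> rvec measure" where
  "param_space d \<Theta> = restrict_space (Rd d) \<Theta>"

definition population_risk ::
    "(rvec \<Rightarrow> 'z \<Rightarrow> real) \<Rightarrow> 'z measure \<Rightarrow> rvec \<Rightarrow> real" where
  "population_risk f D \<theta> = (\<integral>z. f \<theta> z \<partial>D)"

type_synonym 'z sco = "rvec set \<times> 'z measure \<times> (rvec \<Rightarrow> 'z \<Rightarrow> real)"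

text \<open>
  The integrability clause says that the population risk is well defined for every distribution
  on the data space; without it, the Bochner integral would be an arbitrary \<open>0\<close>.  It
  includes measurability of \<open>f \<theta>\<close>.  Nonemptiness of \<open>\<Theta>\<close> and of the data space
  excludes problems without learning algorithms or without data distributions.
\<close>

definition sco_problem :: "nat \<Rightarrow> 'z sco \<Rightarrow> bool" where
  "sco_problem d = (\<lambda>(\<Theta>, Z, f).
     \<Theta> \<subseteq> space (Rd d) \<and> \<Theta> \<noteq> {} \<and> convex_Rd d \<Theta> \<and>
     space Z \<noteq> {} \<and>
     (\<forall>z\<in>space Z. convex_on_Rd d \<Theta> (\<lambda>\<theta>. f \<theta> z)) \<and>
     (\<forall>D\<in>prob_measures Z. \<forall>\<theta>\<in>\<Theta>. integrable D (f \<theta>)))"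

definition lp_sco_problems :: "real \<Rightarrow> nat \<Rightarrow> 'z sco set" where
  "lp_sco_problems p d = {(\<Theta>, Z, f). sco_problem d (\<Theta>, Z, f) \<and>
     \<Theta> \<subseteq> lp_ball p d 1 \<and>
     (\<forall>\<theta>\<^sub>1\<in>\<Theta>. \<forall>\<theta>\<^sub>2\<in>\<Theta>. \<forall>z\<in>space Z.
        \<bar>f \<theta>\<^sub>1 z - f \<theta>\<^sub>2 z\<bar> \<le> lp_norm p d (\<lambda>i. \<theta>\<^sub>1 i - \<theta>\<^sub>2 i))}"

text \<open>
  Samples are indexed by \<open>{1..n}\<close>, leaving index \<open>0\<close> for the fresh point \<open>Z\<^sub>0\<close>.
  A randomized algorithm is a Markov kernel from samples to \<open>\<Theta>\<close>.
\<close>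

definition learning_algorithm ::
    "nat \<Rightarrow> nat \<Rightarrow> 'z sco \<Rightarrow> ((nat \<Rightarrow> 'z) \<Rightarrow> rvec measure) \<Rightarrow> bool" where
  "learning_algorithm d n = (\<lambda>(\<Theta>, Z, f) A.
     A \<in> Pi\<^sub>M {1..n} (\<lambda>_. Z) \<rightarrow>\<^sub>M prob_algebra (param_space d \<Theta>))"

text \<open>The bind below is the law of \<open>\<theta>\<close> drawn from \<open>A S\<close> with \<open>S\<close> drawn from the
  \<open>n\<close>-fold product of \<open>D\<close>.\<close>

definition alpha_learner ::
    "nat \<Rightarrow> nat \<Rightarrow> real \<Rightarrow> 'z sco \<Rightarrow> ((nat \<Rightarrow> 'z) \<Rightarrow> rvec measure) \<Rightarrow> bool" where
  "alpha_learner d n \<alpha> = (\<lambda>(\<Theta>, Z, f) A.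
     learning_algorithm d n (\<Theta>, Z, f) A \<and>
     (\<forall>D\<in>prob_measures Z.
        (\<integral>\<theta>. population_risk f D \<theta> \<partial>(Pi\<^sub>M {1..n} (\<lambda>_. D) \<bind> A))
          - (INF \<theta>\<in>\<Theta>. population_risk f D \<theta>) \<le> \<alpha>))"

text \<open>
  The joint law of \<open>(\<theta>, (Z\<^sub>0, \<dots>, Z\<^sub>n))\<close>, where \<open>\<theta>\<close> is drawn from
  \<open>A (Z\<^sub>1, \<dots>, Z\<^sub>n)\<close>.
\<close>

definition trace_law ::
    "nat \<Rightarrow> nat \<Rightarrow> rvec set \<Rightarrow> ((nat \<Rightarrow> 'z) \<Rightarrow> rvec measure) \<Rightarrow> 'z measure
      \<Rightarrow> (rvec \<times> (nat \<Rightarrow> 'z)) measure" where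
  "trace_law d n \<Theta> A D =
     (Pi\<^sub>M {0..n} (\<lambda>_. D) \<bind> (\<lambda>s. A (restrict s {1..n}) \<bind>
        (\<lambda>\<theta>. return (param_space d \<Theta> \<Otimes>\<^sub>M Pi\<^sub>M {0..n} (\<lambda>_. D)) (\<theta>, s))))"

definition tracer ::
    "nat \<Rightarrow> 'z sco \<Rightarrow> (rvec \<times> 'z \<Rightarrow> real) \<Rightarrow> 'z measure \<Rightarrow> bool" where
  "tracer d = (\<lambda>(\<Theta>, Z, f) \<phi> D.
     \<phi> \<in> borel_measurable (param_space d \<Theta> \<Otimes>\<^sub>M Z) \<and> D \<in> prob_measures Z)"

definition traceable ::
    "nat \<Rightarrow> nat \<Rightarrow> real \<Rightarrow> real \<Rightarrow> 'z sco \<Rightarrow> ((nat \<Rightarrow> 'z) \<Rightarrow> rvec measure) \<Rightarrow> bool" where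
  "traceable d n \<xi> m = (\<lambda>(\<Theta>, Z, f) A.
     \<exists>\<phi> D \<kappa>. tracer d (\<Theta>, Z, f) \<phi> D \<and>
       measure (trace_law d n \<Theta> A D)
         {(\<theta>, s) \<in> space (trace_law d n \<Theta> A D). \<phi> (\<theta>, s 0) \<ge> \<kappa>} \<le> \<xi> \<and>
       (\<integral>(\<theta>, s). real (card {i \<in> {1..n}. \<phi> (\<theta>, s i) \<ge> \<kappa>}) \<partial>trace_law d n \<Theta> A D) \<ge> m)"

end

theory Submission
  imports Defs
begin

text \<open>
  The hard problem is linear: \<open>\<Theta>\<close> is the cube of side \<open>2r\<close> with \<open>r = d powr (-1/p)\<close>, the data are
  sign vectors, and the loss is \<open>-\<langle>\<theta>, z\<rangle> / (d r)\<close>. The data law has independent coordinates with means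
  \<open>\<mu>\<^sub>i \<in> [-a, a]\<close>, \<open>a = 4\<alpha>\<close>, so an \<open>\<alpha>\<close>-learner must have \<open>\<theta> / r\<close> correlated with \<open>\<mu>\<close>. Averaging over
  a uniform \<open>\<mu>\<close> and integrating by parts in each coordinate turns this correlation into a total
  score of order \<open>d / \<alpha>\<close> on the sample, where \<open>\<phi> \<theta> z = \<Sum>\<^sub>i (\<theta>\<^sub>i / r) w(\<mu>\<^sub>i) (z\<^sub>i - \<mu>\<^sub>i)\<close>. A fresh point has
  score at least \<open>\<kappa> = \<surd>(2 d ln (1/\<xi>))\<close> with probability at most \<open>\<xi>\<close>, and the points of score below \<open>\<kappa>\<close>
  contribute at most \<open>n \<kappa>\<close>, which is a small part of the total. Finally, a union bound over all
  subsets \<open>T\<close> of the sample and all sign vectors shows that the points of \<open>T\<close> carry a total score of at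
  most about \<open>d \<surd>|T|\<close> (here \<open>n \<le> d\<close> enters), so at least about \<open>1/\<alpha>\<^sup>2\<close> points are traced.
\<close>

section \<open>Product laws of biased signs and their exponential moments\<close>

definition sign_cube :: "nat \<Rightarrow> rvec set" where
  "sign_cube d = {..<d} \<rightarrow>\<^sub>E {-1, 1}"

text \<open>For a sign \<open>z i\<close>, the factor \<open>(1 + z i * \<mu> i) / 2\<close> is the
  probability of \<open>z i\<close> under mean \<open>\<mu> i\<close>. Written this way it is affine
  in \<open>\<mu> i\<close>, so the likelihood can be differentiated and integrated in the
  bias.\<close>

definition bias_mass :: "nat \<Rightarrow> rvec \<Rightarrow> rvec \<Rightarrow> real" where
  "bias_mass d \<mu> z = (\<Prod>i<d. (1 + z i * \<mu> i) / 2)"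

text \<open>
  The factor \<open>a\<^sup>2 - t\<^sup>2\<close> kills the boundary terms of the integration by parts over \<open>[-a, a]\<close>;
  \<open>1 - t\<^sup>2\<close> is the variance of a sign \<open>\<sigma>\<close> of mean \<open>t\<close>, whose score is \<open>(\<sigma> - t) / (1 - t\<^sup>2)\<close>.
\<close>

definition score_weight :: "real \<Rightarrow> real \<Rightarrow> real" where
  "score_weight a t = (a\<^sup>2 - t\<^sup>2) / (a\<^sup>2 * (1 - t\<^sup>2))"

lemma finite_sign_cube [simp, intro]: "finite (sign_cube d)"
  unfolding sign_cube_def by (intro finite_PiE) auto

lemma sign_cube_nonempty [simp]: "sign_cube d \<noteq> {}"
  unfolding sign_cube_def by (auto simp: PiE_eq_empty_iff)

lemma sign_cube_nth: "z \<in> sign_cube d \<Longrightarrow> i < d \<Longrightarrow> z i = -1 \<or> z i = 1"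
  unfolding sign_cube_def by (auto simp: PiE_iff)

lemma bias_mass_nonneg:
  assumes "\<And>i. i < d \<Longrightarrow> \<bar>\<mu> i\<bar> \<le> 1" "z \<in> sign_cube d"
  shows "0 \<le> bias_mass d \<mu> z"
  unfolding bias_mass_def
proof (intro prod_nonneg)
  fix i assume "i \<in> {..<d}"
  then show "0 \<le> (1 + z i * \<mu> i) / 2"
    using assms(1)[of i] sign_cube_nth[OF assms(2), of i] by (auto simp: abs_le_iff)
qed

text \<open>Independence of the coordinates in algebraic form: expanding a product of two-term sums
  gives a sum over the cube. Total mass, coordinate means and exponential moments are all
  instances.\<close>

lemma sum_bias_mass_prod:
  "(\<Sum>z\<in>sign_cube d. bias_mass d \<mu> z * (\<Prod>i<d. h i (z i)))
    = (\<Prod>i<d. (1 + \<mu> i) / 2 * h i 1 + (1 - \<mu> i) / 2 * h i (-1))"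
proof -
  have "(\<Prod>i<d. (1 + \<mu> i) / 2 * h i 1 + (1 - \<mu> i) / 2 * h i (-1))
      = (\<Prod>i<d. \<Sum>t\<in>{-1, 1}. (1 + t * \<mu> i) / 2 * h i t)"
    by (intro prod.cong) auto
  also have "\<dots> = (\<Sum>z\<in>sign_cube d. \<Prod>i<d. (1 + z i * \<mu> i) / 2 * h i (z i))"
    unfolding sign_cube_def by (rule prod_sum_PiE) auto
  finally show ?thesis
    unfolding bias_mass_def prod.distrib ..
qed

lemma sum_bias_mass: "(\<Sum>z\<in>sign_cube d. bias_mass d \<mu> z) = 1"
  using sum_bias_mass_prod[of d \<mu> "\<lambda>_ _. 1"] by (simp add: field_simps)

lemma sum_bias_mass_nth:
  assumes "i < d"
  shows "(\<Sum>z\<in>sign_cube d. bias_mass d \<mu> z * z i) = \<mu> i"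
proof -
  have "(\<Prod>k<d. if k = i then z k else 1) = z i" for z :: rvec
    using assms by (simp add: prod.delta')
  then have "(\<Sum>z\<in>sign_cube d. bias_mass d \<mu> z * z i)
      = (\<Prod>k<d. (1 + \<mu> k) / 2 * (if k = i then 1 else 1) + (1 - \<mu> k) / 2 * (if k = i then -1 else 1))"
    using sum_bias_mass_prod[of d \<mu> "\<lambda>k t. if k = i then t else 1"] by simp
  also have "\<dots> = (\<Prod>k<d. if k = i then \<mu> k else 1)"
    by (intro prod.cong) (auto simp: field_simps)
  also have "\<dots> = \<mu> i"
    using assms by (simp add: prod.delta')
  finally show ?thesis .
qed

text \<open>Hoeffding's lemma for a centred sign of mean \<open>m\<close>. The two values are at
  distance 2, so the variance proxy is 1, uniformly in \<open>m\<close>.\<close>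

lemma two_point_mgf:
  fixes m b :: real
  assumes "\<bar>m\<bar> \<le> 1"
  shows "(1 + m) / 2 * exp (b * (1 - m)) + (1 - m) / 2 * exp (b * (-1 - m)) \<le> exp (b\<^sup>2 / 2)"
proof -
  have *: "(1 + m) / 2 * exp (b * (1 - m)) + (1 - m) / 2 * exp (b * (-1 - m)) \<le> exp (b\<^sup>2 / 2)"
    if m: "\<bar>m\<bar> \<le> 1" and b: "0 \<le> b" for m b :: real
  proof -
    \<comment> \<open>\<open>q\<close> is the probability of the sign +1. The factor 2 in the
      exponent \<open>2 * b\<close> is the distance between the two values.\<close>
    define q where "q = (1 + m) / 2"
    have q: "0 \<le> q" using m by (auto simp: q_def)
    have pos: "0 < 1 + q * (exp (2 * b) - 1)"
      using q b by (intro add_pos_nonneg mult_nonneg_nonneg) auto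
    have "- (2 * b) * q + ln (1 + q * (exp (2 * b) - 1)) \<le> (2 * b)\<^sup>2 / 8"
      using Hoeffdings_lemma_aux[of "2 * b" q] q b by simp
    then have "exp (- (2 * b) * q + ln (1 + q * (exp (2 * b) - 1))) \<le> exp (b\<^sup>2 / 2)"
      by (simp add: power2_eq_square)
    moreover have "exp (- (2 * b) * q + ln (1 + q * (exp (2 * b) - 1)))
        = exp (- (2 * b) * q) * (1 + q * (exp (2 * b) - 1))"
      unfolding exp_add using pos by simp
    moreover have "\<dots> = q * (exp (- (2 * b) * q) * exp (2 * b)) + (1 - q) * exp (- (2 * b) * q)"
      by (simp add: algebra_simps)
    moreover have "exp (- (2 * b) * q) * exp (2 * b) = exp (b * (1 - m))"
      unfolding exp_add[symmetric] by (rule arg_cong[where f=exp]) (simp add: q_def field_simps)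
    moreover have "exp (- (2 * b) * q) = exp (b * (-1 - m))"
      by (rule arg_cong[where f=exp]) (simp add: q_def field_simps)
    moreover have "1 - q = (1 - m) / 2"
      by (simp add: q_def field_simps)
    ultimately have "q * exp (b * (1 - m)) + (1 - m) / 2 * exp (b * (-1 - m)) \<le> exp (b\<^sup>2 / 2)"
      by (simp only:)
    then show ?thesis
      unfolding q_def .
  qed
  show ?thesis
  proof (cases "0 \<le> b")
    case True
    then show ?thesis using * assms by blast
  next
    case False
    \<comment> \<open>Flipping the sign of the variable exchanges the two summands and reduces
      negative \<open>b\<close> to the first case.\<close>
    then show ?thesis using *[of "-m" "-b"] assms by (simp add: algebra_simps)
  qed
qed

text \<open>By independence the exponential moment factors over the coordinates, and each factor is
  bounded by \<open>two_point_mgf\<close>. The bound does not depend on the bias.\<close>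

lemma bias_mass_mgf:
  fixes \<mu> b :: rvec
  assumes "\<And>i. i < d \<Longrightarrow> \<bar>\<mu> i\<bar> \<le> 1"
  shows "(\<Sum>z\<in>sign_cube d. bias_mass d \<mu> z * exp (\<Sum>i<d. b i * (z i - \<mu> i)))
    \<le> exp ((\<Sum>i<d. (b i)\<^sup>2) / 2)"
proof -
  have "(\<Sum>z\<in>sign_cube d. bias_mass d \<mu> z * exp (\<Sum>i<d. b i * (z i - \<mu> i)))
      = (\<Prod>i<d. (1 + \<mu> i) / 2 * exp (b i * (1 - \<mu> i)) + (1 - \<mu> i) / 2 * exp (b i * (-1 - \<mu> i)))"
    by (simp add: exp_sum sum_bias_mass_prod[where h="\<lambda>i t. exp (b i * (t - \<mu> i))"])
  also have "\<dots> \<le> (\<Prod>i<d. exp ((b i)\<^sup>2 / 2))"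
  proof (intro prod_mono conjI two_point_mgf add_nonneg_nonneg mult_nonneg_nonneg)
    fix i assume "i \<in> {..<d}"
    then show "\<bar>\<mu> i\<bar> \<le> 1" "0 \<le> (1 + \<mu> i) / 2" "0 \<le> (1 - \<mu> i) / 2"
      using assms[of i] by (auto simp: abs_le_iff)
  qed auto
  finally show ?thesis
    by (simp add: exp_sum sum_divide_distrib)
qed

text \<open>The index set is a parameter because the same mass serves the sample
  \<open>{1..n}\<close> and the sample extended by the fresh point, \<open>{0..n}\<close>.\<close>

definition sample_mass :: "nat \<Rightarrow> rvec \<Rightarrow> nat set \<Rightarrow> (nat \<Rightarrow> rvec) \<Rightarrow> real" where
  "sample_mass d \<mu> J s = (\<Prod>j\<in>J. bias_mass d \<mu> (s j))"

lemma sum_sample_mass_prod: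
  assumes "finite J"
  shows "(\<Sum>s\<in>J \<rightarrow>\<^sub>E sign_cube d. sample_mass d \<mu> J s * (\<Prod>j\<in>J. h j (s j)))
    = (\<Prod>j\<in>J. \<Sum>z\<in>sign_cube d. bias_mass d \<mu> z * h j z)"
  unfolding sample_mass_def prod.distrib[symmetric]
  by (rule prod_sum_PiE[symmetric]) (use assms in auto)

lemma sum_sample_mass: "finite J \<Longrightarrow> (\<Sum>s\<in>J \<rightarrow>\<^sub>E sign_cube d. sample_mass d \<mu> J s) = 1"
  using sum_sample_mass_prod[of J d \<mu> "\<lambda>_ _. 1"] by (simp add: sum_bias_mass)

lemma sample_mass_nonneg:
  assumes "\<And>i. i < d \<Longrightarrow> \<bar>\<mu> i\<bar> \<le> 1" "s \<in> J \<rightarrow>\<^sub>E sign_cube d"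
  shows "0 \<le> sample_mass d \<mu> J s"
  unfolding sample_mass_def using assms by (intro prod_nonneg bias_mass_nonneg) auto

text \<open>Points outside \<open>T\<close> contribute their total mass 1, and each point of
  \<open>T\<close> contributes one factor bounded by \<open>bias_mass_mgf\<close>.\<close>

lemma sample_mass_mgf:
  fixes \<mu> b :: rvec
  assumes "finite J" "T \<subseteq> J" and \<mu>: "\<And>i. i < d \<Longrightarrow> \<bar>\<mu> i\<bar> \<le> 1"
  shows "(\<Sum>s\<in>J \<rightarrow>\<^sub>E sign_cube d. sample_mass d \<mu> J s * exp (\<Sum>j\<in>T. \<Sum>i<d. b i * (s j i - \<mu> i)))
    \<le> exp (card T * (\<Sum>i<d. (b i)\<^sup>2) / 2)"
proof -
  define h where "h j z = (if j \<in> T then exp (\<Sum>i<d. b i * (z i - \<mu> i)) else 1)" for j :: nat and z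
  have *: "exp (\<Sum>j\<in>T. \<Sum>i<d. b i * (s j i - \<mu> i)) = (\<Prod>j\<in>J. h j (s j))" for s :: "nat \<Rightarrow> rvec"
    unfolding h_def prod.inter_restrict[OF \<open>finite J\<close>, symmetric]
    using assms by (simp add: exp_sum finite_subset Int_absorb1)
  have "(\<Sum>s\<in>J \<rightarrow>\<^sub>E sign_cube d. sample_mass d \<mu> J s * exp (\<Sum>j\<in>T. \<Sum>i<d. b i * (s j i - \<mu> i)))
      = (\<Prod>j\<in>J. \<Sum>z\<in>sign_cube d. bias_mass d \<mu> z * h j z)"
    unfolding * by (rule sum_sample_mass_prod[OF \<open>finite J\<close>])
  also have "\<dots> \<le> (\<Prod>j\<in>J. if j \<in> T then exp ((\<Sum>i<d. (b i)\<^sup>2) / 2) else 1)"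
    using bias_mass_mgf[of d \<mu> b, OF \<mu>]
    by (intro prod_mono) (auto simp: h_def sum_bias_mass intro!: sum_nonneg mult_nonneg_nonneg bias_mass_nonneg \<mu>)
  also have "\<dots> = exp ((\<Sum>i<d. (b i)\<^sup>2) / 2) ^ card T"
    unfolding prod.inter_restrict[OF \<open>finite J\<close>, symmetric]
    using assms by (simp add: Int_absorb1)
  finally show ?thesis
    by (simp add: exp_of_nat_mult[symmetric])
qed

section \<open>Score integrals under the uniform prior and the fingerprinting inequality\<close>

lemma score_weight_bounds:
  assumes "0 < a" "a < 1" "\<bar>t\<bar> \<le> a"
  shows "0 \<le> score_weight a t" "score_weight a t \<le> 1"
proof -
  have t: "t\<^sup>2 \<le> a\<^sup>2" using assms by (simp add: abs_le_square_iff[symmetric])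
  have a: "a\<^sup>2 < 1" using assms by (simp add: abs_square_less_1)
  show "0 \<le> score_weight a t"
    unfolding score_weight_def using t a by (intro divide_nonneg_nonneg mult_nonneg_nonneg) auto
  have "t\<^sup>2 * a\<^sup>2 \<le> t\<^sup>2 * 1" using a by (intro mult_left_mono) auto
  then have "a\<^sup>2 - t\<^sup>2 \<le> a\<^sup>2 * (1 - t\<^sup>2)" by (simp add: algebra_simps)
  moreover have "0 < a\<^sup>2 * (1 - t\<^sup>2)" using t a assms by (intro mult_pos_pos) auto
  ultimately show "score_weight a t \<le> 1"
    unfolding score_weight_def by simp
qed

text \<open>The integrand is the derivative of \<open>(a\<^sup>2 - t\<^sup>2) / a\<^sup>2 * (\<Prod>j\<in>J. (1 + \<sigma> j * t) / 2)\<close>.\<close>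

lemma score_integral_zero:
  fixes \<sigma> :: "nat \<Rightarrow> real"
  assumes a: "0 < a" "a < 1" and J: "finite J" and \<sigma>: "\<And>j. j \<in> J \<Longrightarrow> \<sigma> j = -1 \<or> \<sigma> j = 1"
  shows "(\<integral>t. (score_weight a t * (\<Sum>j\<in>J. \<sigma> j - t) - 2 * t / a\<^sup>2) * (\<Prod>j\<in>J. (1 + \<sigma> j * t) / 2)
      \<partial>restrict_space lborel {-a..a}) = 0"
proof -
  define P where "P t = (\<Prod>j\<in>J. (1 + \<sigma> j * t) / 2)" for t
  define h where "h t = (score_weight a t * (\<Sum>j\<in>J. \<sigma> j - t) - 2 * t / a\<^sup>2) * P t" for t
  have lt1: "t\<^sup>2 < 1" if "-a \<le> t" "t \<le> a" for t
    using that a by (intro power2_less_1_iff[THEN iffD2]) auto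
  have ne: "1 + \<sigma> j * t \<noteq> 0" if "j \<in> J" "-a \<le> t" "t \<le> a" for j t
    using \<sigma>[OF that(1)] that a by auto
  have P': "(P has_real_derivative P t * (\<Sum>j\<in>J. \<sigma> j / (1 + \<sigma> j * t))) (at t)"
    if "-a \<le> t" "t \<le> a" for t
  proof -
    have "((\<lambda>t. \<Prod>j\<in>J. (1 + \<sigma> j * t) / 2) has_real_derivative
        (\<Prod>j\<in>J. (1 + \<sigma> j * t) / 2) * (\<Sum>j\<in>J. (\<sigma> j / 2) / ((1 + \<sigma> j * t) / 2))) (at t)"
      by (rule has_field_derivative_prod') (use ne that in \<open>auto intro!: derivative_eq_intros\<close>)
    then show ?thesis
      unfolding P_def by simp
  qed
  \<comment> \<open>Since \<sigma> j squares to 1, \<open>(1 + \<sigma> j * t) * (\<sigma> j - t) =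
    \<sigma> j * (1 - t\<^sup>2)\<close>. So the logarithmic derivative of each likelihood factor is
    a centred sign over a variance that is the same for all \<open>j\<close>.\<close>
  have sig: "\<sigma> j / (1 + \<sigma> j * t) = (\<sigma> j - t) / (1 - t\<^sup>2)" if "j \<in> J" "-a \<le> t" "t \<le> a" for j t
    using \<sigma>[OF that(1)] ne[OF that] lt1[OF that(2,3)] by (auto simp: field_simps power2_eq_square)
  have D: "((\<lambda>t. (a\<^sup>2 - t\<^sup>2) / a\<^sup>2 * P t) has_real_derivative h t) (at t)"
    if t: "-a \<le> t" "t \<le> a" for t
  proof -
    have "(\<Sum>j\<in>J. \<sigma> j / (1 + \<sigma> j * t)) = (\<Sum>j\<in>J. \<sigma> j - t) / (1 - t\<^sup>2)"
      using sig[OF _ t] by (simp add: sum_divide_distrib)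
    then have P'': "(P has_real_derivative P t * ((\<Sum>j\<in>J. \<sigma> j - t) / (1 - t\<^sup>2))) (at t)"
      using P'[OF t] by simp
    have "((\<lambda>t. (a\<^sup>2 - t\<^sup>2) / a\<^sup>2 * P t) has_real_derivative
        (- 2 * t / a\<^sup>2) * P t + P t * ((\<Sum>j\<in>J. \<sigma> j - t) / (1 - t\<^sup>2)) * ((a\<^sup>2 - t\<^sup>2) / a\<^sup>2)) (at t)"
      by (rule DERIV_mult[OF _ P'']) (use a in \<open>auto intro!: derivative_eq_intros simp: field_simps power2_eq_square\<close>)
    moreover have "(- 2 * t / a\<^sup>2) * P t + P t * ((\<Sum>j\<in>J. \<sigma> j - t) / (1 - t\<^sup>2)) * ((a\<^sup>2 - t\<^sup>2) / a\<^sup>2) = h t"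
      unfolding h_def score_weight_def by (simp add: algebra_simps)
    ultimately show ?thesis by simp
  qed
  have cont: "isCont h t" if t: "-a \<le> t" "t \<le> a" for t
    unfolding h_def score_weight_def P_def
    using lt1[OF t] a by (intro continuous_intros) auto
  have "(\<integral>t. h t \<partial>restrict_space lborel {-a..a}) = (\<integral>t. h t * indicator {-a..a} t \<partial>lborel)"
    by (subst integral_restrict_space) (auto simp: mult.commute)
  also have "\<dots> = 0"
    by (subst integral_FTC_Icc_real[of "-a" a "\<lambda>t. (a\<^sup>2 - t\<^sup>2) / a\<^sup>2 * P t" h]) (use D cont a in auto)
  finally show ?thesis
    unfolding h_def P_def .
qed

text \<open>\<open>a / 3\<close> is the mean of \<open>t\<^sup>2 / a\<close> under the uniform law
  on \<open>[-a, a]\<close>. It is the average correlation per coordinate that a perfect learner is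
  credited with.\<close>

lemma quadratic_integral_zero:
  assumes a: "0 < a"
  shows "(\<integral>t. t\<^sup>2 / a - a / 3 \<partial>restrict_space lborel {-a..(a::real)}) = 0"
proof -
  have "(\<integral>t. t\<^sup>2 / a - a / 3 \<partial>restrict_space lborel {-a..a})
      = (\<integral>t. (t\<^sup>2 / a - a / 3) * indicator {-a..a} t \<partial>lborel)"
    by (subst integral_restrict_space) (auto simp: mult.commute)
  also have "\<dots> = 0"
    by (subst integral_FTC_Icc_real[of "-a" a "\<lambda>t. t ^ 3 / (3 * a) - a * t / 3"])
       (use a in \<open>auto intro!: derivative_eq_intros continuous_intros simp: field_simps power2_eq_square power3_eq_cube\<close>)
  finally show ?thesis .
qed

text \<open>By Fubini, one coordinate with vanishing integral annihilates the whole product. The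
  integration by parts is carried out in coordinate \<open>i\<close>, while the other factors may be
  arbitrary continuous functions.\<close>

lemma integral_PiM_prod_zero:
  fixes f :: "nat \<Rightarrow> real \<Rightarrow> real"
  assumes "0 < a" "i < d" and f: "\<And>k. k < d \<Longrightarrow> continuous_on {-a..a} (f k)"
    and zero: "(\<integral>t. f i t \<partial>restrict_space lborel {-a..a}) = 0"
  shows "integrable (Pi\<^sub>M {..<d} (\<lambda>_. restrict_space lborel {-a..a})) (\<lambda>\<mu>. \<Prod>k<d. f k (\<mu> k))"
    and "(\<integral>\<mu>. (\<Prod>k<d. f k (\<mu> k)) \<partial>Pi\<^sub>M {..<d} (\<lambda>_. restrict_space lborel {-a..a})) = 0"
proof -
  let ?U = "restrict_space lborel {-a..a}"
  have "finite_measure ?U"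
    by (intro finite_measureI) (auto simp: emeasure_restrict_space space_restrict_space emeasure_lborel_Icc_eq)
  then interpret product_sigma_finite "\<lambda>_::nat. ?U"
    by unfold_locales (rule sigma_finite_measure.sigma_finite_countable, rule finite_measure.axioms(1))
  have int: "integrable ?U (f k)" if "k < d" for k
    using borel_integrable_atLeastAtMost'[OF f[OF that]]
    by (subst integrable_restrict_space) (auto simp: set_integrable_def)
  show "integrable (Pi\<^sub>M {..<d} (\<lambda>_. ?U)) (\<lambda>\<mu>. \<Prod>k<d. f k (\<mu> k))"
    by (rule product_integrable_prod) (use int in auto)
  have "(\<integral>\<mu>. (\<Prod>k<d. f k (\<mu> k)) \<partial>Pi\<^sub>M {..<d} (\<lambda>_. ?U)) = (\<Prod>k<d. integral\<^sup>L ?U (f k))"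
    by (rule product_integral_prod) (use int in auto)
  also have "\<dots> = 0"
    using zero \<open>i < d\<close> by (intro prod_zero) auto
  finally show "(\<integral>\<mu>. (\<Prod>k<d. f k (\<mu> k)) \<partial>Pi\<^sub>M {..<d} (\<lambda>_. ?U)) = 0" .
qed

text \<open>The function \<open>g\<close> depends on the sample but not on the bias. Integration by
  parts therefore equates the prior averages of the score correlation \<open>G\<close> and of
  \<open>2 / a\<^sup>2\<close> times the mean correlation \<open>C\<close>. If \<open>G\<close> were
  below the claimed value at every bias, the combination \<open>H\<close> would be negative
  everywhere although its integral is zero.\<close>

lemma fingerprinting:
  fixes g :: "(nat \<Rightarrow> rvec) \<Rightarrow> nat \<Rightarrow> real"
  assumes a: "0 < a" "a < 1" and J: "finite J"
    and acc: "\<And>\<mu>. (\<And>i. i < d \<Longrightarrow> \<bar>\<mu> i\<bar> \<le> a) \<Longrightarrow>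
      (\<Sum>i<d. \<bar>\<mu> i\<bar>) - d * \<alpha>
        \<le> (\<Sum>s\<in>J \<rightarrow>\<^sub>E sign_cube d. sample_mass d \<mu> J s * (\<Sum>i<d. \<mu> i * g s i))"
  shows "\<exists>\<mu>. (\<forall>i<d. \<bar>\<mu> i\<bar> \<le> a) \<and>
    2 / a\<^sup>2 * (d * (a / 3 - \<alpha>))
      \<le> (\<Sum>s\<in>J \<rightarrow>\<^sub>E sign_cube d. sample_mass d \<mu> J s *
          (\<Sum>i<d. g s i * (score_weight a (\<mu> i) * (\<Sum>j\<in>J. s j i - \<mu> i))))"
proof (rule ccontr)
  let ?S = "J \<rightarrow>\<^sub>E sign_cube d"
  let ?U = "restrict_space lborel {-a..a}"
  let ?M = "Pi\<^sub>M {..<d} (\<lambda>_. ?U)"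
  define G where "G \<mu> = (\<Sum>s\<in>?S. sample_mass d \<mu> J s *
    (\<Sum>i<d. g s i * (score_weight a (\<mu> i) * (\<Sum>j\<in>J. s j i - \<mu> i))))" for \<mu>
  define C where "C \<mu> = (\<Sum>s\<in>?S. sample_mass d \<mu> J s * (\<Sum>i<d. \<mu> i * g s i))" for \<mu>
  assume "\<not> ?thesis"
  then have small: "G \<mu> < 2 / a\<^sup>2 * (d * (a / 3 - \<alpha>))" if "\<And>i. i < d \<Longrightarrow> \<bar>\<mu> i\<bar> \<le> a" for \<mu>
    using that unfolding G_def by (meson not_le_imp_less)
  \<comment> \<open>Both parts of \<open>H\<close> are written as products over coordinates so that
    \<open>integral_PiM_prod_zero\<close> applies. \<open>f s i k\<close> is the likelihood of
    column \<open>k\<close> of the sample, and for \<open>k = i\<close> it becomes the integrand of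
    \<open>score_integral_zero\<close>.\<close>
  define f where "f s i k t = (if k = i then score_weight a t * (\<Sum>j\<in>J. s j i - t) - 2 * t / a\<^sup>2 else 1)
      * (\<Prod>j\<in>J. (1 + s j k * t) / 2)" for s :: "nat \<Rightarrow> rvec" and i k t
  define e where "e i k t = (if k = i then t\<^sup>2 / a - a / 3 else 1)" for i k :: nat and t :: real
  define H where "H \<mu> = (\<Sum>s\<in>?S. \<Sum>i<d. g s i * (\<Prod>k<d. f s i k (\<mu> k)))
      + 2 / a\<^sup>2 * (\<Sum>i<d. \<Prod>k<d. e i k (\<mu> k))" for \<mu> :: rvec
  have prod_f: "(\<Prod>k<d. f s i k (\<mu> k))
      = (score_weight a (\<mu> i) * (\<Sum>j\<in>J. s j i - \<mu> i) - 2 * \<mu> i / a\<^sup>2) * sample_mass d \<mu> J s"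
    if "i < d" for s i \<mu>
  proof -
    have "(\<Prod>k<d. \<Prod>j\<in>J. (1 + s j k * \<mu> k) / 2) = sample_mass d \<mu> J s"
      unfolding sample_mass_def bias_mass_def by (rule prod.swap)
    then show ?thesis
      unfolding f_def prod.distrib using that
      by (simp add: prod.delta)
  qed
  have prod_e: "(\<Prod>k<d. e i k (\<mu> k)) = (\<mu> i)\<^sup>2 / a - a / 3" if "i < d" for i \<mu>
    unfolding e_def using that by (simp add: prod.delta)
  have H: "H \<mu> = G \<mu> - 2 / a\<^sup>2 * C \<mu> + 2 / a\<^sup>2 * (\<Sum>i<d. (\<mu> i)\<^sup>2 / a - a / 3)" for \<mu>
  proof -
    have "(\<Sum>s\<in>?S. \<Sum>i<d. g s i * (\<Prod>k<d. f s i k (\<mu> k))) = G \<mu> - 2 / a\<^sup>2 * C \<mu>"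
    proof -
      define D where "D s i = (\<Sum>j\<in>J. s j i - \<mu> i)" for s :: "nat \<Rightarrow> rvec" and i
      show ?thesis
        unfolding G_def C_def D_def[symmetric] sum_distrib_left sum_subtractf[symmetric]
        by (intro sum.cong refl) (simp add: prod_f D_def[symmetric] algebra_simps)
    qed
    then show ?thesis
      unfolding H_def by (simp add: prod_e)
  qed
  \<comment> \<open>\<open>t\<^sup>2 / a\<close> replaces \<open>\<bar>t\<bar>\<close> to keep the prior average a polynomial integral.\<close>
  have neg: "H \<mu> < 0" if \<mu>: "\<And>i. i < d \<Longrightarrow> \<bar>\<mu> i\<bar> \<le> a" for \<mu>
  proof -
    have "(\<mu> i)\<^sup>2 / a \<le> \<bar>\<mu> i\<bar>" if "i < d" for i
    proof -
      have "\<bar>\<mu> i\<bar> * \<bar>\<mu> i\<bar> \<le> a * \<bar>\<mu> i\<bar>" using \<mu>[OF that] by (intro mult_right_mono) auto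
      then show ?thesis using a by (simp add: field_simps power2_eq_square)
    qed
    then have "(\<Sum>i<d. (\<mu> i)\<^sup>2 / a - a / 3) \<le> (\<Sum>i<d. \<bar>\<mu> i\<bar> - a / 3)"
      by (intro sum_mono) auto
    also have "\<dots> = (\<Sum>i<d. \<bar>\<mu> i\<bar>) - d * (a / 3)"
      by (simp add: sum_subtractf)
    finally have "(\<Sum>i<d. (\<mu> i)\<^sup>2 / a - a / 3) - C \<mu> \<le> - (d * (a / 3 - \<alpha>))"
      using acc[of \<mu>, OF \<mu>] unfolding C_def by (simp add: algebra_simps)
    then have "2 / a\<^sup>2 * ((\<Sum>i<d. (\<mu> i)\<^sup>2 / a - a / 3) - C \<mu>) \<le> 2 / a\<^sup>2 * - (d * (a / 3 - \<alpha>))"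
      by (rule mult_left_mono) auto
    then show ?thesis
      using small[of \<mu>, OF \<mu>] unfolding H by (simp add: algebra_simps)
  qed
  have cont_f: "continuous_on {-a..a} (f s i k)" for s i k
  proof -
    have "t\<^sup>2 \<noteq> 1" if "t \<in> {-a..a}" for t
      using that a by (auto simp: power2_eq_1_iff)
    then have "continuous_on {-a..a} (\<lambda>t. score_weight a t * (\<Sum>j\<in>J. s j i - t) - 2 * t / a\<^sup>2)"
      unfolding score_weight_def using a by (intro continuous_intros) auto
    then show ?thesis
      unfolding f_def by (cases "k = i") (auto intro!: continuous_intros)
  qed
  have cont_e: "continuous_on {-a..a} (e i k)" for i k
    unfolding e_def using a by (cases "k = i") (auto intro!: continuous_intros)
  have zero_f: "(\<integral>t. f s i i t \<partial>?U) = 0" if "s \<in> ?S" "i < d" for s i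
  proof -
    have "s j i = -1 \<or> s j i = 1" if "j \<in> J" for j
      using \<open>s \<in> ?S\<close> \<open>i < d\<close> that sign_cube_nth by (auto simp: PiE_iff)
    from score_integral_zero[OF a J this] show ?thesis
      unfolding f_def by simp
  qed
  have zero_e: "(\<integral>t. e i i t \<partial>?U) = 0" for i
    unfolding e_def using quadratic_integral_zero[OF a(1)] by simp
  note f_int = integral_PiM_prod_zero[OF a(1), where d = d and f = "f s i" for s i, OF _ cont_f zero_f]
  note e_int = integral_PiM_prod_zero[OF a(1), where d = d and f = "e i" for i, OF _ cont_e zero_e]
  have hf: "has_bochner_integral ?M (\<lambda>\<mu>. \<Prod>k<d. f s i k (\<mu> k)) 0" if "s \<in> ?S" "i < d" for s i
    using f_int[OF that(2,1) that(2)] by (simp add: has_bochner_integral_iff)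
  have he: "has_bochner_integral ?M (\<lambda>\<mu>. \<Prod>k<d. e i k (\<mu> k)) 0" if "i < d" for i
    using e_int[OF that] by (simp add: has_bochner_integral_iff)
  have "has_bochner_integral ?M H ((\<Sum>s\<in>?S. \<Sum>i<d. g s i * 0) + 2 / a\<^sup>2 * (\<Sum>i<d. 0))"
    unfolding H_def
    by (intro has_bochner_integral_add has_bochner_integral_sum has_bochner_integral_mult_right hf he) auto
  then have "integrable ?M H" "integral\<^sup>L ?M H = 0"
    by (simp_all add: has_bochner_integral_iff)
  \<comment> \<open>The prior is left unnormalised. Its mass \<open>(2 * a) ^ d\<close> is positive,
    which makes the inequality between the integrals strict.\<close>
  moreover have "integral\<^sup>L ?M H < integral\<^sup>L ?M (\<lambda>_. 0)"
  proof -
    have fin: "finite_measure ?U"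
      by (intro finite_measureI) (auto simp: emeasure_restrict_space space_restrict_space emeasure_lborel_Icc_eq)
    then interpret product_sigma_finite "\<lambda>_::nat. ?U"
      by unfold_locales (rule sigma_finite_measure.sigma_finite_countable, rule finite_measure.axioms(1))
    have "emeasure ?M (space ?M) = (\<Prod>k<d. emeasure ?U (space ?U))"
      unfolding space_PiM by (rule emeasure_PiM) (auto simp: sets_restrict_space_iff)
    also have "\<dots> = ennreal ((2 * a) ^ d)"
      using a by (simp add: emeasure_restrict_space space_restrict_space ennreal_power)
    finally have mass: "emeasure ?M (space ?M) = ennreal ((2 * a) ^ d)" .
    interpret M: finite_measure ?M
      by (intro finite_measureI) (simp add: mass)
    show ?thesis
    proof (rule M.integral_less_AE_space)
      show "AE \<mu> in ?M. H \<mu> < 0"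
        by (intro AE_I2 neg) (auto simp: space_PiM PiE_iff space_restrict_space abs_le_iff minus_le_iff)
    qed (use \<open>integrable ?M H\<close> a mass in auto)
  qed
  ultimately show False by simp
qed

section \<open>Uniform control of the total score of a selected subsample\<close>

text \<open>
  \<open>T\<close> and \<open>x\<close> may depend on \<open>s\<close>. The bound is the union bound in exponential form, hence the
  penalty linear in \<open>card T\<close>; optimising over \<open>l\<close> gives the order \<open>\<surd>(d (card J + d) card T)\<close>.
\<close>

lemma selected_score_bound:
  fixes \<mu> w :: rvec and l :: real
  assumes \<mu>: "\<And>i. i < d \<Longrightarrow> \<bar>\<mu> i\<bar> \<le> 1" and w: "\<And>i. i < d \<Longrightarrow> \<bar>w i\<bar> \<le> 1"
    and J: "finite J" and "0 < l"
  shows "\<exists>W.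
    (\<forall>s. \<forall>T\<subseteq>J. \<forall>x. (\<forall>i<d. \<bar>x i\<bar> \<le> 1) \<longrightarrow>
      (\<Sum>j\<in>T. \<Sum>i<d. x i * w i * (s j i - \<mu> i)) \<le> l * d * card T / 2 + W s) \<and>
    (\<Sum>s\<in>J \<rightarrow>\<^sub>E sign_cube d. sample_mass d \<mu> J s * W s) \<le> (card J + d) / l"
proof -
  let ?S = "J \<rightarrow>\<^sub>E sign_cube d"
  define A where "A x T s = l * (\<Sum>j\<in>T. \<Sum>i<d. x i * w i * (s j i - \<mu> i)) - l\<^sup>2 * d * card T / 2"
    for x :: rvec and T :: "nat set" and s :: "nat \<Rightarrow> rvec"
  define V where "V s = (\<Sum>T\<in>Pow J. \<Sum>x\<in>sign_cube d. exp (A x T s))" for s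
  \<comment> \<open>\<open>exp K\<close> is the number of pairs of a subset of \<open>J\<close> and
    a sign vector. \<open>W\<close> comes from the tangent inequality u \<le> K - 1 + exp (u - K).
    This bound is linear in the exponential, so the expectation of \<open>W\<close> follows directly
    from that of \<open>V\<close>.\<close>
  define K where "K = (card J + d) * ln (2::real)"
  define W where "W s = (K - 1 + exp (- K) * V s) / l" for s
  have le_V: "exp (A x T s) \<le> V s" if T: "T \<subseteq> J" and x: "\<And>i. i < d \<Longrightarrow> \<bar>x i\<bar> \<le> 1" for x T s
  proof -
    \<comment> \<open>The total score is linear in \<open>x\<close>, so over the cube it is largest
      at a vertex. Finitely many sign vectors thus control all real \<open>x\<close> with entries in
      [-1, 1].\<close>
    define y where "y = (\<lambda>i\<in>{..<d}. if 0 \<le> w i * (\<Sum>j\<in>T. s j i - \<mu> i) then 1 else (-1::real))"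
    have y: "y \<in> sign_cube d"
      unfolding y_def sign_cube_def by (auto simp: PiE_iff)
    have swap: "(\<Sum>j\<in>T. \<Sum>i<d. x i * w i * (s j i - \<mu> i)) = (\<Sum>i<d. x i * (w i * (\<Sum>j\<in>T. s j i - \<mu> i)))" for x
      by (subst sum.swap) (simp add: sum_distrib_left mult.assoc)
    have "x i * c \<le> \<bar>c\<bar>" if "i < d" for i c
    proof -
      have "x i * c \<le> \<bar>x i\<bar> * \<bar>c\<bar>" by (metis abs_ge_self abs_mult)
      also have "\<dots> \<le> 1 * \<bar>c\<bar>" using x[OF that] by (intro mult_right_mono) auto
      finally show ?thesis by simp
    qed
    then have "(\<Sum>i<d. x i * (w i * (\<Sum>j\<in>T. s j i - \<mu> i))) \<le> (\<Sum>i<d. y i * (w i * (\<Sum>j\<in>T. s j i - \<mu> i)))"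
    proof (intro sum_mono)
      fix i assume i: "i \<in> {..<d}"
      have "y i * c = \<bar>c\<bar>" if "c = w i * (\<Sum>j\<in>T. s j i - \<mu> i)" for c
        using i unfolding y_def that by (simp add: abs_if)
      with \<open>\<And>i c. i < d \<Longrightarrow> x i * c \<le> \<bar>c\<bar>\<close> i
      show "x i * (w i * (\<Sum>j\<in>T. s j i - \<mu> i)) \<le> y i * (w i * (\<Sum>j\<in>T. s j i - \<mu> i))"
        by simp
    qed
    then have "A x T s \<le> A y T s"
      unfolding A_def swap using \<open>0 < l\<close> by simp
    then have "exp (A x T s) \<le> exp (A y T s)" by simp
    also have "\<dots> \<le> (\<Sum>x\<in>sign_cube d. exp (A x T s))"
      by (rule member_le_sum[OF y]) auto
    also have "\<dots> \<le> V s"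
      unfolding V_def by (rule member_le_sum) (use T J in \<open>auto intro: sum_nonneg\<close>)
    finally show ?thesis .
  qed
  have "(\<Sum>j\<in>T. \<Sum>i<d. x i * w i * (s j i - \<mu> i)) \<le> l * d * card T / 2 + W s"
    if T: "T \<subseteq> J" and x: "\<And>i. i < d \<Longrightarrow> \<bar>x i\<bar> \<le> 1" for x T s
  proof -
    have "A x T s \<le> K - 1 + exp (A x T s - K)"
      using exp_ge_add_one_self[of "A x T s - K"] by linarith
    also have "exp (A x T s - K) = exp (- K) * exp (A x T s)"
      by (simp add: exp_diff exp_minus field_simps)
    also have "\<dots> \<le> exp (- K) * V s"
      using le_V[OF T x] by (intro mult_left_mono) auto
    finally have "A x T s \<le> l * W s"
      unfolding W_def using \<open>0 < l\<close> by simp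
    then have "l * (\<Sum>j\<in>T. \<Sum>i<d. x i * w i * (s j i - \<mu> i)) \<le> l * (l * d * card T / 2 + W s)"
      unfolding A_def by (simp add: algebra_simps power2_eq_square)
    then show ?thesis
      using \<open>0 < l\<close> by (simp only: mult_le_cancel_left_pos)
  qed
  moreover have "(\<Sum>s\<in>?S. sample_mass d \<mu> J s * W s) \<le> (card J + d) / l"
  proof -
    \<comment> \<open>\<open>A\<close> subtracts the bound on the logarithm of the exponential
      moment, so each term of \<open>V\<close> has expectation at most 1.\<close>
    have one: "(\<Sum>s\<in>?S. sample_mass d \<mu> J s * exp (A x T s)) \<le> 1" if x: "x \<in> sign_cube d" and T: "T \<subseteq> J" for x T
    proof -
      have "(\<Sum>s\<in>?S. sample_mass d \<mu> J s * exp (A x T s))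
          = exp (- (l\<^sup>2 * d * card T / 2)) *
            (\<Sum>s\<in>?S. sample_mass d \<mu> J s * exp (\<Sum>j\<in>T. \<Sum>i<d. (l * x i * w i) * (s j i - \<mu> i)))"
      proof -
        have *: "A x T s = - (l\<^sup>2 * d * card T / 2) + (\<Sum>j\<in>T. \<Sum>i<d. (l * x i * w i) * (s j i - \<mu> i))" for s
          unfolding A_def by (simp add: sum_distrib_left mult.assoc)
        then show ?thesis
          unfolding * exp_add sum_distrib_left by (intro sum.cong refl) simp
      qed
      also have "\<dots> \<le> exp (- (l\<^sup>2 * d * card T / 2)) * exp (card T * (\<Sum>i<d. (l * x i * w i)\<^sup>2) / 2)"
        using sample_mass_mgf[of J T d \<mu> "\<lambda>i. l * x i * w i", OF J T \<mu>] by (intro mult_left_mono) auto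
      also have "\<dots> \<le> exp (- (l\<^sup>2 * d * card T / 2)) * exp (l\<^sup>2 * d * card T / 2)"
      proof -
        have "(l * x i * w i)\<^sup>2 \<le> l\<^sup>2" if "i < d" for i
        proof -
          have "(x i)\<^sup>2 = 1" using sign_cube_nth[OF x that] by auto
          moreover have "(w i)\<^sup>2 \<le> 1" using w[OF that] by (simp add: abs_square_le_1)
          ultimately show ?thesis using mult_left_mono[of "(w i)\<^sup>2" 1 "l\<^sup>2"] by (simp add: power_mult_distrib)
        qed
        then have "(\<Sum>i<d. (l * x i * w i)\<^sup>2) \<le> d * l\<^sup>2"
          using sum_bounded_above[of "{..<d}" "\<lambda>i. (l * x i * w i)\<^sup>2" "l\<^sup>2"] by simp
        then have "card T * (\<Sum>i<d. (l * x i * w i)\<^sup>2) \<le> card T * (d * l\<^sup>2)"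
          by (intro mult_left_mono) auto
        then show ?thesis by (simp add: mult_ac)
      qed
      also have "\<dots> = 1" by (simp add: exp_minus)
      finally show ?thesis .
    qed
    have "(\<Sum>s\<in>?S. sample_mass d \<mu> J s * V s)
        = (\<Sum>T\<in>Pow J. \<Sum>x\<in>sign_cube d. \<Sum>s\<in>?S. sample_mass d \<mu> J s * exp (A x T s))"
      unfolding V_def sum_distrib_left
      by (subst sum.swap) (simp add: sum.swap[of _ "?S"])
    also have "\<dots> \<le> (\<Sum>T\<in>Pow J. \<Sum>x\<in>sign_cube d. 1)"
      by (intro sum_mono one) auto
    also have "\<dots> = 2 ^ (card J + d)"
      using J by (simp add: card_Pow sign_cube_def card_funcsetE power_add)
    also have "\<dots> = exp K"
      unfolding K_def exp_of_nat_mult by simp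
    finally have V: "(\<Sum>s\<in>?S. sample_mass d \<mu> J s * V s) \<le> exp K" .
    have "(\<Sum>s\<in>?S. sample_mass d \<mu> J s * W s)
        = ((K - 1) * (\<Sum>s\<in>?S. sample_mass d \<mu> J s) + exp (- K) * (\<Sum>s\<in>?S. sample_mass d \<mu> J s * V s)) / l"
      unfolding W_def sum_distrib_left add_divide_distrib sum_divide_distrib sum.distrib[symmetric]
      by (intro sum.cong refl) (simp add: algebra_simps add_divide_distrib)
    also have "\<dots> \<le> ((K - 1) + exp (- K) * exp K) / l"
      using V \<open>0 < l\<close> J by (intro divide_right_mono add_mono mult_left_mono) (auto simp: sum_sample_mass)
    also have "\<dots> = K / l" by (simp add: exp_minus)
    also have "\<dots> \<le> (card J + d) / l"
    proof -
      have "ln (2::real) \<le> 1" using ln_le_minus_one[of "2::real"] by simp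
      then show ?thesis
        unfolding K_def using \<open>0 < l\<close> mult_left_mono[of "ln 2" 1 "real (card J + d)"]
        by (intro divide_right_mono) auto
    qed
    finally show ?thesis .
  qed
  ultimately show ?thesis by blast
qed

section \<open>Expectations over samples, outputs and traces as finite sums\<close>

text \<open>All subsets of the finite cube are measurable, so every function of a data point is
  measurable and every integral over the data is a finite sum.\<close>

definition bias_measure :: "nat \<Rightarrow> rvec \<Rightarrow> rvec measure" where
  "bias_measure d \<mu> = point_measure (sign_cube d) (\<lambda>z. ennreal (bias_mass d \<mu> z))"

lemma space_bias_measure [simp]: "space (bias_measure d \<mu>) = sign_cube d"
  by (simp add: bias_measure_def space_point_measure)

lemma sets_bias_measure [measurable_cong]: "sets (bias_measure d \<mu>) = sets (count_space (sign_cube d))"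
  by (simp add: bias_measure_def sets_point_measure)

lemma prob_space_bias_measure:
  assumes "\<And>i. i < d \<Longrightarrow> \<bar>\<mu> i\<bar> \<le> 1"
  shows "prob_space (bias_measure d \<mu>)"
proof (rule prob_spaceI)
  have "emeasure (bias_measure d \<mu>) (sign_cube d) = (\<Sum>z\<in>sign_cube d. ennreal (bias_mass d \<mu> z))"
    unfolding bias_measure_def by (rule emeasure_point_measure_finite) auto
  also have "\<dots> = ennreal (\<Sum>z\<in>sign_cube d. bias_mass d \<mu> z)"
    by (rule sum_ennreal) (use assms in \<open>auto intro: bias_mass_nonneg\<close>)
  finally show "emeasure (bias_measure d \<mu>) (space (bias_measure d \<mu>)) = 1"
    by (simp add: sum_bias_mass)
qed

lemma bias_measure_in_prob_measures:
  assumes "\<And>i. i < d \<Longrightarrow> \<bar>\<mu> i\<bar> \<le> 1"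
  shows "bias_measure d \<mu> \<in> prob_measures (count_space (sign_cube d))"
  using prob_space_bias_measure[OF assms] by (simp add: space_prob_algebra sets_bias_measure)

lemma integral_bias_measure:
  fixes h :: "rvec \<Rightarrow> real"
  assumes "\<And>i. i < d \<Longrightarrow> \<bar>\<mu> i\<bar> \<le> 1"
  shows "(\<integral>z. h z \<partial>bias_measure d \<mu>) = (\<Sum>z\<in>sign_cube d. bias_mass d \<mu> z * h z)"
  unfolding bias_measure_def
  by (subst lebesgue_integral_point_measure_finite) (use assms in \<open>auto intro: bias_mass_nonneg\<close>)

lemma sets_PiM_bias_measure:
  "finite J \<Longrightarrow> sets (Pi\<^sub>M J (\<lambda>_. bias_measure d \<mu>)) = sets (count_space (J \<rightarrow>\<^sub>E sign_cube d))"
  by (subst sets_PiM_cong[OF refl sets_bias_measure])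
     (simp add: count_space_PiM_finite countable_finite)

text \<open>On a finite space with all subsets measurable it suffices to compare singletons, and a
  singleton is a box whose mass is the product of the point masses.\<close>

lemma PiM_bias_measure:
  assumes "finite J" and \<mu>: "\<And>i. i < d \<Longrightarrow> \<bar>\<mu> i\<bar> \<le> 1"
  shows "Pi\<^sub>M J (\<lambda>_. bias_measure d \<mu>)
    = point_measure (J \<rightarrow>\<^sub>E sign_cube d) (\<lambda>s. ennreal (sample_mass d \<mu> J s))"
proof (rule measure_eqI_finite)
  show "finite (J \<rightarrow>\<^sub>E sign_cube d)" using assms by (intro finite_PiE) auto
  show "sets (Pi\<^sub>M J (\<lambda>_. bias_measure d \<mu>)) = Pow (J \<rightarrow>\<^sub>E sign_cube d)"
    using assms by (simp add: sets_PiM_bias_measure)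
  show "sets (point_measure (J \<rightarrow>\<^sub>E sign_cube d) (\<lambda>s. ennreal (sample_mass d \<mu> J s))) = Pow (J \<rightarrow>\<^sub>E sign_cube d)"
    by (simp add: sets_point_measure)
  fix s assume s: "s \<in> J \<rightarrow>\<^sub>E sign_cube d"
  interpret product_prob_space "\<lambda>_::nat. bias_measure d \<mu>"
    by (rule product_prob_spaceI) (rule prob_space_bias_measure[OF \<mu>])
  have "{s} = (\<Pi>\<^sub>E j\<in>J. {s j})"
    using s by (auto simp: PiE_iff extensional_def fun_eq_iff) (metis)
  then have "emeasure (Pi\<^sub>M J (\<lambda>_. bias_measure d \<mu>)) {s}
      = emeasure (Pi\<^sub>M J (\<lambda>_. bias_measure d \<mu>)) (\<Pi>\<^sub>E j\<in>J. {s j})" by simp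
  also have "\<dots> = (\<Prod>j\<in>J. emeasure (bias_measure d \<mu>) {s j})"
    by (rule emeasure_PiM) (use s assms in \<open>auto simp: sets_bias_measure PiE_iff\<close>)
  also have "\<dots> = (\<Prod>j\<in>J. ennreal (bias_mass d \<mu> (s j)))"
    unfolding bias_measure_def
    by (intro prod.cong refl, subst emeasure_point_measure_finite) (use s in \<open>auto simp: PiE_iff\<close>)
  also have "\<dots> = ennreal (sample_mass d \<mu> J s)"
    unfolding sample_mass_def
    by (rule prod_ennreal) (use s \<mu> in \<open>auto intro!: bias_mass_nonneg\<close>)
  finally show "emeasure (Pi\<^sub>M J (\<lambda>_. bias_measure d \<mu>)) {s}
      = emeasure (point_measure (J \<rightarrow>\<^sub>E sign_cube d) (\<lambda>s. ennreal (sample_mass d \<mu> J s))) {s}"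
    using s assms by (subst emeasure_point_measure_finite) (auto intro!: finite_PiE)
qed

lemma integral_PiM_bias_measure:
  fixes h :: "(nat \<Rightarrow> rvec) \<Rightarrow> real"
  assumes "finite J" and \<mu>: "\<And>i. i < d \<Longrightarrow> \<bar>\<mu> i\<bar> \<le> 1"
  shows "(\<integral>s. h s \<partial>Pi\<^sub>M J (\<lambda>_. bias_measure d \<mu>))
    = (\<Sum>s\<in>J \<rightarrow>\<^sub>E sign_cube d. sample_mass d \<mu> J s * h s)"
proof -
  have "Pi\<^sub>M J (\<lambda>_. bias_measure d \<mu>)
      = point_measure (J \<rightarrow>\<^sub>E sign_cube d) (\<lambda>s. ennreal (sample_mass d \<mu> J s))"
    using assms by (rule PiM_bias_measure)
  then show ?thesis
    by (simp add: lebesgue_integral_point_measure_finite finite_PiE sample_mass_nonneg assms)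
qed

lemma prob_space_PiM_bias_measure:
  assumes "\<And>i. i < d \<Longrightarrow> \<bar>\<mu> i\<bar> \<le> 1"
  shows "prob_space (Pi\<^sub>M J (\<lambda>_. bias_measure d \<mu>))"
  by (rule prob_space_PiM) (rule prob_space_bias_measure[OF assms])

text \<open>Fubini for one distinguished point. With \<open>k = 0\<close> it separates the fresh
  point from the sample that the algorithm sees.\<close>

lemma sum_sample_mass_insert:
  assumes "finite J" "k \<notin> J"
  shows "(\<Sum>s\<in>insert k J \<rightarrow>\<^sub>E sign_cube d. sample_mass d \<mu> (insert k J) s * h (s k) (restrict s J))
    = (\<Sum>s\<in>J \<rightarrow>\<^sub>E sign_cube d. sample_mass d \<mu> J s * (\<Sum>z\<in>sign_cube d. bias_mass d \<mu> z * h z s))"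
proof -
  have upd: "restrict (s(k := z)) J = s" if "s \<in> J \<rightarrow>\<^sub>E sign_cube d" for s z
    using that assms by (auto simp: fun_eq_iff PiE_iff extensional_def)
  have mass: "sample_mass d \<mu> (insert k J) (s(k := z)) = bias_mass d \<mu> z * sample_mass d \<mu> J s" for s z
  proof -
    have "(\<Prod>j\<in>J. bias_mass d \<mu> ((s(k := z)) j)) = (\<Prod>j\<in>J. bias_mass d \<mu> (s j))"
      using assms by (intro prod.cong) auto
    then show ?thesis
      unfolding sample_mass_def using assms by simp
  qed
  have "(\<Sum>s\<in>insert k J \<rightarrow>\<^sub>E sign_cube d. sample_mass d \<mu> (insert k J) s * h (s k) (restrict s J))
      = (\<Sum>(z, s)\<in>sign_cube d \<times> (J \<rightarrow>\<^sub>E sign_cube d). bias_mass d \<mu> z * sample_mass d \<mu> J s * h z s)"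
    unfolding PiE_insert_eq
    by (subst sum.reindex[OF inj_combinator[OF assms(2)]])
       (auto intro!: sum.cong simp: upd mass)
  also have "\<dots> = (\<Sum>s\<in>J \<rightarrow>\<^sub>E sign_cube d. \<Sum>z\<in>sign_cube d. bias_mass d \<mu> z * sample_mass d \<mu> J s * h z s)"
    by (subst sum.cartesian_product[symmetric]) (rule sum.swap)
  finally show ?thesis
    by (simp add: sum_distrib_left mult_ac)
qed

lemma integral_bind_kernel:
  fixes h :: "'b \<Rightarrow> real"
  assumes "prob_space M" and K: "K \<in> M \<rightarrow>\<^sub>M prob_algebra N"
    and h: "h \<in> borel_measurable N" "\<And>x. x \<in> space N \<Longrightarrow> \<bar>h x\<bar> \<le> B"
  shows "(\<integral>x. h x \<partial>(M \<bind> K)) = (\<integral>s. (\<integral>x. h x \<partial>K s) \<partial>M)"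
proof (rule integral_bind[OF h])
  show "K \<in> M \<rightarrow>\<^sub>M subprob_algebra N" using K by (rule measurable_prob_algebraD)
  show "finite_measure M" using assms(1) by (rule prob_space.finite_measure)
  show "AE s in M. emeasure (K s) (space (K s)) \<le> ennreal 1"
    using measurable_space[OF K] by (intro AE_I2) (simp add: space_prob_algebra prob_space.emeasure_space_1)
qed

lemma kernel_prob:
  assumes A: "A \<in> Pi\<^sub>M {1..n} (\<lambda>_. count_space (sign_cube d)) \<rightarrow>\<^sub>M prob_algebra (param_space d \<Theta>)"
    and "s \<in> {1..n} \<rightarrow>\<^sub>E sign_cube d"
  shows "prob_space (A s)" "sets (A s) = sets (param_space d \<Theta>)" "space (A s) = space (param_space d \<Theta>)"
proof -
  have "s \<in> space (Pi\<^sub>M {1..n} (\<lambda>_. count_space (sign_cube d)))"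
    using assms by (simp add: space_PiM)
  from measurable_space[OF A this]
  show *: "prob_space (A s)" "sets (A s) = sets (param_space d \<Theta>)"
    by (auto simp: space_prob_algebra)
  show "space (A s) = space (param_space d \<Theta>)"
    using *(2) by (rule sets_eq_imp_space_eq)
qed

context
  fixes d n :: nat and \<Theta> :: "rvec set" and A :: "(nat \<Rightarrow> rvec) \<Rightarrow> rvec measure" and \<mu> :: rvec
  assumes A: "A \<in> Pi\<^sub>M {1..n} (\<lambda>_. count_space (sign_cube d)) \<rightarrow>\<^sub>M prob_algebra (param_space d \<Theta>)"
    and \<mu>: "\<And>i. i < d \<Longrightarrow> \<bar>\<mu> i\<bar> \<le> 1"
begin

lemma kernel_measurable: "A \<in> Pi\<^sub>M {1..n} (\<lambda>_. bias_measure d \<mu>) \<rightarrow>\<^sub>M prob_algebra (param_space d \<Theta>)"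
  using A by (subst measurable_cong_sets[OF sets_PiM_cong[OF refl sets_bias_measure] refl])

lemma integral_output_law:
  fixes h :: "rvec \<Rightarrow> real"
  assumes "h \<in> borel_measurable (param_space d \<Theta>)" "\<And>\<theta>. \<theta> \<in> space (param_space d \<Theta>) \<Longrightarrow> \<bar>h \<theta>\<bar> \<le> B"
  shows "(\<integral>\<theta>. h \<theta> \<partial>(Pi\<^sub>M {1..n} (\<lambda>_. bias_measure d \<mu>) \<bind> A))
    = (\<Sum>s\<in>{1..n} \<rightarrow>\<^sub>E sign_cube d. sample_mass d \<mu> {1..n} s * (\<integral>\<theta>. h \<theta> \<partial>A s))"
  by (subst integral_bind_kernel[OF prob_space_PiM_bias_measure[OF \<mu>] kernel_measurable assms])
     (auto simp: integral_PiM_bias_measure[OF _ \<mu>])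

text \<open>For a fixed sample, binding with \<open>return\<close> is the image of the output law
  under pairing with that sample. Measurability of the resulting kernel in \<open>s\<close> comes
  from the discreteness of the sample space.\<close>

lemma trace_law_eq:
  "trace_law d n \<Theta> A (bias_measure d \<mu>) =
    Pi\<^sub>M {0..n} (\<lambda>_. bias_measure d \<mu>) \<bind> (\<lambda>s. distr (A (restrict s {1..n}))
      (param_space d \<Theta> \<Otimes>\<^sub>M Pi\<^sub>M {0..n} (\<lambda>_. bias_measure d \<mu>)) (\<lambda>\<theta>. (\<theta>, s)))"
  and trace_kernel_measurable:
  "(\<lambda>s. distr (A (restrict s {1..n}))
      (param_space d \<Theta> \<Otimes>\<^sub>M Pi\<^sub>M {0..n} (\<lambda>_. bias_measure d \<mu>)) (\<lambda>\<theta>. (\<theta>, s)))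
    \<in> Pi\<^sub>M {0..n} (\<lambda>_. bias_measure d \<mu>) \<rightarrow>\<^sub>M
      prob_algebra (param_space d \<Theta> \<Otimes>\<^sub>M Pi\<^sub>M {0..n} (\<lambda>_. bias_measure d \<mu>))"
  (is "?K \<in> ?M \<rightarrow>\<^sub>M prob_algebra ?N")
proof -
  have res: "restrict s {1..n} \<in> {1..n} \<rightarrow>\<^sub>E sign_cube d" if "s \<in> space ?M" for s
    using that by (auto simp: space_PiM PiE_iff)
  have pair: "(\<lambda>\<theta>. (\<theta>, s)) \<in> A (restrict s {1..n}) \<rightarrow>\<^sub>M ?N" if s: "s \<in> space ?M" for s
    using s by (subst measurable_cong_sets[OF kernel_prob(2)[OF A res[OF s]] refl]) measurable
  show "trace_law d n \<Theta> A (bias_measure d \<mu>) = ?M \<bind> ?K"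
    unfolding trace_law_def
  proof (intro bind_cong_All ballI)
    fix s assume s: "s \<in> space ?M"
    show "A (restrict s {1..n}) \<bind> (\<lambda>\<theta>. return ?N (\<theta>, s)) = ?K s"
      using prob_space.not_empty[OF kernel_prob(1)[OF A res[OF s]]] pair[OF s] by (rule bind_return_distr')
  qed
  show "?K \<in> ?M \<rightarrow>\<^sub>M prob_algebra ?N"
    using prob_space.prob_space_distr[OF kernel_prob(1)[OF A res] pair]
    by (subst measurable_cong_sets[OF sets_PiM_bias_measure refl])
       (simp_all add: space_prob_algebra space_PiM)
qed

text \<open>The data part of the trace law becomes a finite sum, and only the randomness of the
  algorithm remains as an integral.\<close>

lemma integral_trace_law:
  fixes h :: "rvec \<times> (nat \<Rightarrow> rvec) \<Rightarrow> real"
  assumes h: "h \<in> borel_measurable (param_space d \<Theta> \<Otimes>\<^sub>M Pi\<^sub>M {0..n} (\<lambda>_. bias_measure d \<mu>))"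
    and B: "\<And>x. \<bar>h x\<bar> \<le> B"
  shows "(\<integral>x. h x \<partial>trace_law d n \<Theta> A (bias_measure d \<mu>))
    = (\<Sum>s\<in>{0..n} \<rightarrow>\<^sub>E sign_cube d. sample_mass d \<mu> {0..n} s * (\<integral>\<theta>. h (\<theta>, s) \<partial>A (restrict s {1..n})))"
proof -
  have "(\<integral>x. h x \<partial>trace_law d n \<Theta> A (bias_measure d \<mu>))
      = (\<Sum>s\<in>{0..n} \<rightarrow>\<^sub>E sign_cube d. sample_mass d \<mu> {0..n} s *
          (\<integral>x. h x \<partial>distr (A (restrict s {1..n}))
            (param_space d \<Theta> \<Otimes>\<^sub>M Pi\<^sub>M {0..n} (\<lambda>_. bias_measure d \<mu>)) (\<lambda>\<theta>. (\<theta>, s))))"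
    unfolding trace_law_eq
    by (subst integral_bind_kernel[OF prob_space_PiM_bias_measure[OF \<mu>] trace_kernel_measurable h B])
       (auto simp: integral_PiM_bias_measure[OF _ \<mu>])
  also have "\<dots> = (\<Sum>s\<in>{0..n} \<rightarrow>\<^sub>E sign_cube d. sample_mass d \<mu> {0..n} s *
      (\<integral>\<theta>. h (\<theta>, s) \<partial>A (restrict s {1..n})))"
  proof (intro sum.cong refl arg_cong2[where f="(*)"])
    fix s assume s: "s \<in> {0..n} \<rightarrow>\<^sub>E sign_cube d"
    then have r: "restrict s {1..n} \<in> {1..n} \<rightarrow>\<^sub>E sign_cube d" by (auto simp: PiE_iff)
    have sp: "s \<in> space (Pi\<^sub>M {0..n} (\<lambda>_. bias_measure d \<mu>))" using s by (simp add: space_PiM)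
    show "(\<integral>x. h x \<partial>distr (A (restrict s {1..n}))
            (param_space d \<Theta> \<Otimes>\<^sub>M Pi\<^sub>M {0..n} (\<lambda>_. bias_measure d \<mu>)) (\<lambda>\<theta>. (\<theta>, s)))
        = (\<integral>\<theta>. h (\<theta>, s) \<partial>A (restrict s {1..n}))"
    proof (rule integral_distr[OF _ h])
      show "(\<lambda>\<theta>. (\<theta>, s)) \<in> A (restrict s {1..n}) \<rightarrow>\<^sub>M param_space d \<Theta> \<Otimes>\<^sub>M Pi\<^sub>M {0..n} (\<lambda>_. bias_measure d \<mu>)"
        using sp by (subst measurable_cong_sets[OF kernel_prob(2)[OF A r] refl]) measurable
    qed
  qed
  finally show ?thesis .
qed

end

section \<open>The linear problem on the cube and the correlation of its learners\<close>

definition cube_params :: "nat \<Rightarrow> real \<Rightarrow> rvec set" where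
  "cube_params d r = {..<d} \<rightarrow>\<^sub>E {-r..r}"

text \<open>Dividing by \<open>d * r\<close> makes the optimal risk equal to minus the average of
  the \<bar>\<mu> i\<bar>, whatever the radius, so accuracy \<alpha> is on the scale of the bias of
  one coordinate.\<close>

definition linear_loss :: "nat \<Rightarrow> real \<Rightarrow> rvec \<Rightarrow> rvec \<Rightarrow> real" where
  "linear_loss d r \<theta> z = - (\<Sum>i<d. \<theta> i * z i) / (d * r)"

definition cube_problem :: "nat \<Rightarrow> real \<Rightarrow> rvec sco" where
  "cube_problem d r = (cube_params d r, count_space (sign_cube d), linear_loss d r)"

text \<open>This is the power mean inequality. The entries are rescaled to mean 1 and compared with
  the tangent of \<open>t powr p\<close> at 1.\<close>

lemma sum_abs_le_lp_norm:
  assumes p: "1 \<le> p" and d: "1 \<le> d"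
  shows "(\<Sum>i<d. \<bar>x i\<bar>) / d \<le> d powr (-1 / p) * lp_norm p d x"
proof (cases "(\<Sum>i<d. \<bar>x i\<bar>) = 0")
  case True
  then show ?thesis by (simp add: lp_norm_def)
next
  case False
  define m where "m = (\<Sum>i<d. \<bar>x i\<bar>) / d"
  have sum_pos: "0 < (\<Sum>i<d. \<bar>x i\<bar>)"
    using False by (simp add: sum_nonneg less_le)
  then have m: "0 < m" using d by (simp add: m_def)
  \<comment> \<open>The point 0 is treated apart because the convexity used is that on the open
    half-line.\<close>
  have tangent: "1 + p * (t - 1) \<le> t powr p" if "0 \<le> t" for t
  proof (cases "t = 0")
    case True
    then show ?thesis using p by simp
  next
    case False
    have "p * (t - 1) \<le> t powr p - 1 powr p"
    proof (rule convex_on_imp_above_tangent[OF powr_convex[OF p]])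
      show "((\<lambda>x. x powr p) has_real_derivative p) (at 1 within {0<..})"
        by (auto intro!: derivative_eq_intros)
    qed (use False that in \<open>auto simp: interior_open\<close>)
    then show ?thesis by simp
  qed
  \<comment> \<open>The quotients \<open>\<bar>x i\<bar> / m\<close> have average 1, so the linear
    terms cancel.\<close>
  have "d = (\<Sum>i<d. 1 + p * (\<bar>x i\<bar> / m - 1))"
  proof -
    have "(\<Sum>i<d. \<bar>x i\<bar> / m) = d"
    proof -
      have "(\<Sum>i<d. \<bar>x i\<bar> / m) = (\<Sum>i<d. \<bar>x i\<bar>) / m"
        by (rule sum_divide_distrib[symmetric])
      then show ?thesis
        using sum_pos d by (simp only: m_def) simp
    qed
    then show ?thesis
      by (simp add: sum.distrib sum_distrib_left[symmetric] sum_subtractf)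
  qed
  also have "\<dots> \<le> (\<Sum>i<d. (\<bar>x i\<bar> / m) powr p)"
    using m by (intro sum_mono tangent) auto
  also have "\<dots> = (\<Sum>i<d. \<bar>x i\<bar> powr p) / m powr p"
    using m by (simp add: powr_divide sum_divide_distrib)
  finally have "d * m powr p \<le> (\<Sum>i<d. \<bar>x i\<bar> powr p)"
    using m by (simp add: field_simps)
  then have "(d * m powr p) powr (1 / p) \<le> lp_norm p d x"
    unfolding lp_norm_def using p by (intro powr_mono2) auto
  moreover have "(d * m powr p) powr (1 / p) = d powr (1 / p) * m"
    using p m by (simp add: powr_mult powr_powr)
  ultimately have "d powr (-1 / p) * (d powr (1 / p) * m) \<le> d powr (-1 / p) * lp_norm p d x"
    by (intro mult_left_mono) auto
  moreover have "d powr (-1 / p) * (d powr (1 / p) * m) = m"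
    using d by (simp add: mult.assoc[symmetric] powr_add[symmetric])
  ultimately show ?thesis unfolding m_def by (simp only:)
qed

text \<open>The radius serves twice. Its \<open>p\<close>-th power is \<open>1 / d\<close>, which
  places the corners of the cube on the unit sphere, and it is the constant in the power mean
  inequality, which makes the Lipschitz constant equal to 1.\<close>

lemma cube_problem_in_lp_sco_problems:
  assumes p: "1 \<le> p" and d: "1 \<le> d"
  shows "cube_problem d (d powr (-1 / p)) \<in> lp_sco_problems p d"
proof -
  define r where "r = d powr (-1 / p)"
  have r: "0 < r" using d by (simp add: r_def)
  have dr: "0 < d * r" using d r by simp
  have convex: "convex_Rd d (cube_params d r)"
    unfolding convex_Rd_def
  proof (intro ballI)
    fix x y t assume x: "x \<in> cube_params d r" and y: "y \<in> cube_params d r" and t: "t \<in> {0..1::real}"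
    have "(1 - t) * x i + t * y i \<in> {-r..r}" if "i < d" for i
    proof -
      have xy: "x i \<in> {-r..r}" "y i \<in> {-r..r}"
        using x y that by (auto simp: cube_params_def PiE_iff)
      have "(1 - t) *\<^sub>R x i + t *\<^sub>R y i \<in> {-r..r}"
        by (rule convexD[OF convex_real_interval(5)]) (use xy t in auto)
      then show ?thesis by simp
    qed
    then show "comb d t x y \<in> cube_params d r"
      by (auto simp: comb_def cube_params_def)
  qed
  have "linear_loss d r (comb d t x y) z = (1 - t) * linear_loss d r x z + t * linear_loss d r y z" for t x y z
  proof -
    have "(\<Sum>i<d. comb d t x y i * z i) = (1 - t) * (\<Sum>i<d. x i * z i) + t * (\<Sum>i<d. y i * z i)"
      unfolding sum_distrib_left sum.distrib[symmetric]
      by (intro sum.cong) (auto simp: comb_def algebra_simps)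
    then show ?thesis
      unfolding linear_loss_def by (simp add: add_divide_distrib diff_divide_distrib)
  qed
  then have loss: "convex_on_Rd d (cube_params d r) (\<lambda>\<theta>. linear_loss d r \<theta> z)" for z
    using convex by (simp add: convex_on_Rd_def)
  have int: "integrable D (linear_loss d r \<theta>)"
    if "D \<in> prob_measures (count_space (sign_cube d))" for D \<theta>
  proof -
    have D: "prob_space D" "sets D = sets (count_space (sign_cube d))"
      using that by (auto simp: space_prob_algebra)
    have sp: "space D = sign_cube d" using sets_eq_imp_space_eq[OF D(2)] by simp
    interpret prob_space D by fact
    show ?thesis
    proof (rule integrable_const_bound)
      show "AE z in D. norm (linear_loss d r \<theta> z) \<le> (\<Sum>z\<in>sign_cube d. \<bar>linear_loss d r \<theta> z\<bar>)"
      proof (rule AE_I2)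
        fix z assume "z \<in> space D"
        then have z: "z \<in> sign_cube d" by (simp add: sp)
        show "norm (linear_loss d r \<theta> z) \<le> (\<Sum>z\<in>sign_cube d. \<bar>linear_loss d r \<theta> z\<bar>)"
          unfolding real_norm_def
          by (rule member_le_sum[OF z, where f="\<lambda>z. \<bar>linear_loss d r \<theta> z\<bar>"]) auto
      qed
      show "linear_loss d r \<theta> \<in> borel_measurable D"
        by (subst measurable_cong_sets[OF D(2) refl]) simp
    qed
  qed
  have ball: "cube_params d r \<subseteq> lp_ball p d 1"
  proof
    fix \<theta> assume \<theta>: "\<theta> \<in> cube_params d r"
    have "(\<Sum>i<d. \<bar>\<theta> i\<bar> powr p) \<le> (\<Sum>i<d. r powr p)"
      using \<theta> p by (intro sum_mono powr_mono2) (auto simp: cube_params_def PiE_iff abs_le_iff minus_le_iff)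
    also have "\<dots> = 1"
    proof -
      have "r powr p = d powr (-1 / p * p)"
        unfolding r_def by (rule powr_powr)
      also have "\<dots> = 1 / d"
        using p d by (simp add: powr_minus divide_inverse)
      finally show ?thesis using d by simp
    qed
    finally have "lp_norm p d \<theta> \<le> 1 powr (1 / p)"
      unfolding lp_norm_def using p by (intro powr_mono2) (auto intro: sum_nonneg)
    then show "\<theta> \<in> lp_ball p d 1"
      using \<theta> by (auto simp: lp_ball_def cube_params_def space_PiM PiE_iff)
  qed
  have lip: "\<bar>linear_loss d r x z - linear_loss d r y z\<bar> \<le> lp_norm p d (\<lambda>i. x i - y i)"
    if z: "z \<in> sign_cube d" for x y z
  proof -
    have "linear_loss d r x z - linear_loss d r y z = - (\<Sum>i<d. (x i - y i) * z i) / (d * r)"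
      unfolding linear_loss_def by (simp add: algebra_simps sum_subtractf diff_divide_distrib)
    then have "\<bar>linear_loss d r x z - linear_loss d r y z\<bar> = \<bar>\<Sum>i<d. (x i - y i) * z i\<bar> / (d * r)"
      using dr by simp
    also have "\<dots> \<le> (\<Sum>i<d. \<bar>(x i - y i) * z i\<bar>) / (d * r)"
      using dr by (intro divide_right_mono sum_abs) auto
    also have "(\<Sum>i<d. \<bar>(x i - y i) * z i\<bar>) = (\<Sum>i<d. \<bar>x i - y i\<bar>)"
    proof (intro sum.cong refl)
      fix i assume "i \<in> {..<d}"
      then have "\<bar>z i\<bar> = 1" using sign_cube_nth[OF z, of i] by auto
      then show "\<bar>(x i - y i) * z i\<bar> = \<bar>x i - y i\<bar>" by (simp add: abs_mult)
    qed
    also have "\<dots> / (d * r) \<le> lp_norm p d (\<lambda>i. x i - y i)"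
    proof -
      have "(\<Sum>i<d. \<bar>x i - y i\<bar>) / d \<le> r * lp_norm p d (\<lambda>i. x i - y i)"
        using sum_abs_le_lp_norm[OF p d, of "\<lambda>i. x i - y i"] unfolding r_def .
      then have "(\<Sum>i<d. \<bar>x i - y i\<bar>) / d / r \<le> lp_norm p d (\<lambda>i. x i - y i)"
        using r by (simp only: pos_divide_le_eq mult.commute)
      then show ?thesis by simp
    qed
    finally show ?thesis .
  qed
  have "(\<lambda>i\<in>{..<d}. 0) \<in> cube_params d r"
    using r by (auto simp: cube_params_def)
  then have "cube_params d r \<noteq> {}" by blast
  moreover have "cube_params d r \<subseteq> space (Rd d)"
    by (auto simp: cube_params_def space_PiM PiE_iff)
  ultimately show ?thesis
    unfolding r_def[symmetric] cube_problem_def lp_sco_problems_def sco_problem_def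
    using convex loss int ball lip by simp
qed

text \<open>The loss is linear in the data point, so averaging replaces the point by its mean
  vector.\<close>

lemma linear_loss_population_risk:
  assumes "\<And>i. i < d \<Longrightarrow> \<bar>\<mu> i\<bar> \<le> 1"
  shows "population_risk (linear_loss d r) (bias_measure d \<mu>) \<theta> = linear_loss d r \<theta> \<mu>"
proof -
  have "(\<Sum>z\<in>sign_cube d. bias_mass d \<mu> z * (\<Sum>i<d. \<theta> i * z i))
      = (\<Sum>i<d. \<theta> i * (\<Sum>z\<in>sign_cube d. bias_mass d \<mu> z * z i))"
    unfolding sum_distrib_left by (subst sum.swap) (simp add: mult_ac)
  also have "\<dots> = (\<Sum>i<d. \<theta> i * \<mu> i)"
    by (simp add: sum_bias_mass_nth)
  finally show ?thesis
    unfolding population_risk_def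
    by (subst integral_bias_measure[OF assms])
       (simp_all add: linear_loss_def sum_divide_distrib[symmetric] sum_negf)
qed

lemma space_param_space_cube [simp]: "space (param_space d (cube_params d r)) = cube_params d r"
  by (auto simp: param_space_def space_restrict_space space_PiM cube_params_def PiE_iff)

lemma measurable_param_nth [measurable]: "i < d \<Longrightarrow> (\<lambda>\<theta>. \<theta> i) \<in> borel_measurable (param_space d \<Theta>)"
  unfolding param_space_def by (intro measurable_restrict_space1 measurable_component_singleton) auto

lemma cube_params_nth: "\<theta> \<in> cube_params d r \<Longrightarrow> i < d \<Longrightarrow> \<bar>\<theta> i\<bar> \<le> r"
  by (auto simp: cube_params_def PiE_iff abs_le_iff minus_le_iff)

text \<open>The risk is minus the normalised correlation of the output with \<mu>, so small excess
  risk means near-maximal correlation. By linearity only the mean output given the sample enters,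
  and this is the function of the sample fed to \<open>fingerprinting\<close>.\<close>

lemma cube_learner_correlation:
  assumes learner: "alpha_learner d n \<alpha> (cube_problem d r) A"
    and r: "0 < r" and d: "1 \<le> d" and \<mu>: "\<And>i. i < d \<Longrightarrow> \<bar>\<mu> i\<bar> \<le> 1"
  shows "(\<Sum>i<d. \<bar>\<mu> i\<bar>) - d * \<alpha>
    \<le> (\<Sum>s\<in>{1..n} \<rightarrow>\<^sub>E sign_cube d. sample_mass d \<mu> {1..n} s * (\<Sum>i<d. \<mu> i * (\<integral>\<theta>. \<theta> i / r \<partial>A s)))"
proof -
  have dr: "0 < d * r" using d r by simp
  have A: "A \<in> Pi\<^sub>M {1..n} (\<lambda>_. count_space (sign_cube d)) \<rightarrow>\<^sub>M prob_algebra (param_space d (cube_params d r))"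
    using learner by (simp add: alpha_learner_def learning_algorithm_def cube_problem_def)
  have bound: "\<bar>linear_loss d r \<theta> \<mu>\<bar> \<le> (\<Sum>i<d. \<bar>\<mu> i\<bar>) / d" if "\<theta> \<in> cube_params d r" for \<theta>
  proof -
    have "\<bar>linear_loss d r \<theta> \<mu>\<bar> \<le> (\<Sum>i<d. \<bar>\<theta> i * \<mu> i\<bar>) / (d * r)"
      unfolding linear_loss_def using dr by (simp add: divide_right_mono)
    also have "\<dots> \<le> (\<Sum>i<d. r * \<bar>\<mu> i\<bar>) / (d * r)"
      using dr cube_params_nth[OF that]
      by (intro divide_right_mono sum_mono) (auto simp: abs_mult intro!: mult_right_mono)
    also have "\<dots> = (\<Sum>i<d. \<bar>\<mu> i\<bar>) / d"
      using r by (simp add: sum_distrib_left[symmetric])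
    finally show ?thesis .
  qed
  have integral_nth: "(\<integral>\<theta>. linear_loss d r \<theta> \<mu> \<partial>A s) = - (\<Sum>i<d. \<mu> i * (\<integral>\<theta>. \<theta> i / r \<partial>A s)) / d"
    if s: "s \<in> {1..n} \<rightarrow>\<^sub>E sign_cube d" for s
  proof -
    note K = kernel_prob[OF A s]
    interpret prob_space "A s" by (rule K(1))
    have "integrable (A s) (\<lambda>\<theta>. \<theta> i / r)" if "i < d" for i
      by (rule integrable_const_bound[where B=1])
         (use r that cube_params_nth in \<open>auto intro!: AE_I2 simp: K measurable_cong_sets[OF K(2) refl]\<close>)
    then have "(\<integral>\<theta>. (\<Sum>i<d. \<mu> i * (\<theta> i / r)) \<partial>A s) = (\<Sum>i<d. \<mu> i * (\<integral>\<theta>. \<theta> i / r \<partial>A s))"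
      by (subst Bochner_Integration.integral_sum) (simp_all del: times_divide_eq_right)
    moreover have "linear_loss d r \<theta> \<mu> = (-1 / d) * (\<Sum>i<d. \<mu> i * (\<theta> i / r))" for \<theta>
      unfolding linear_loss_def by (simp add: sum_divide_distrib[symmetric] mult_ac)
    ultimately show ?thesis by simp
  qed
  \<comment> \<open>Only an upper bound on the infimum is required, and the vertex with the signs of
    \<mu> supplies it. \<open>cINF_lower\<close> also asks for boundedness below, which
    \<open>bound\<close> gives.\<close>
  let ?opt = "\<lambda>i\<in>{..<d}. if 0 \<le> \<mu> i then r else - r"
  have opt: "?opt \<in> cube_params d r" using r by (auto simp: cube_params_def)
  have "(\<Sum>i<d. ?opt i * \<mu> i) = (\<Sum>i<d. r * \<bar>\<mu> i\<bar>)"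
    by (intro sum.cong) auto
  then have "linear_loss d r ?opt \<mu> = - (\<Sum>i<d. \<bar>\<mu> i\<bar>) / d"
    unfolding linear_loss_def using r by (simp add: sum_distrib_left[symmetric])
  moreover have "(INF \<theta>\<in>cube_params d r. linear_loss d r \<theta> \<mu>) \<le> linear_loss d r ?opt \<mu>"
  proof (rule cINF_lower[OF _ opt])
    show "bdd_below ((\<lambda>\<theta>. linear_loss d r \<theta> \<mu>) ` cube_params d r)"
      by (rule bdd_belowI2[where m="- ((\<Sum>i<d. \<bar>\<mu> i\<bar>) / d)"]) (use bound in \<open>fastforce simp: abs_le_iff\<close>)
  qed
  ultimately have inf: "(INF \<theta>\<in>cube_params d r. linear_loss d r \<theta> \<mu>) \<le> - (\<Sum>i<d. \<bar>\<mu> i\<bar>) / d" by simp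
  have "(\<integral>\<theta>. linear_loss d r \<theta> \<mu> \<partial>(Pi\<^sub>M {1..n} (\<lambda>_. bias_measure d \<mu>) \<bind> A))
      - (INF \<theta>\<in>cube_params d r. linear_loss d r \<theta> \<mu>) \<le> \<alpha>"
  proof -
    have "population_risk (linear_loss d r) (bias_measure d \<mu>) = (\<lambda>\<theta>. linear_loss d r \<theta> \<mu>)"
      using linear_loss_population_risk[of d \<mu>, OF \<mu>] by (intro ext)
    moreover have "bias_measure d \<mu> \<in> prob_measures (count_space (sign_cube d))"
      using \<mu> by (rule bias_measure_in_prob_measures)
    ultimately show ?thesis
      using learner unfolding alpha_learner_def cube_problem_def by fastforce
  qed
  moreover have "(\<integral>\<theta>. linear_loss d r \<theta> \<mu> \<partial>(Pi\<^sub>M {1..n} (\<lambda>_. bias_measure d \<mu>) \<bind> A))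
      = (\<Sum>s\<in>{1..n} \<rightarrow>\<^sub>E sign_cube d. sample_mass d \<mu> {1..n} s * (\<integral>\<theta>. linear_loss d r \<theta> \<mu> \<partial>A s))"
    by (rule integral_output_law[OF A \<mu>, where B="(\<Sum>i<d. \<bar>\<mu> i\<bar>) / d"])
       (use bound in \<open>auto simp: linear_loss_def\<close>)
  moreover have "\<dots> = - (\<Sum>s\<in>{1..n} \<rightarrow>\<^sub>E sign_cube d.
      sample_mass d \<mu> {1..n} s * (\<Sum>i<d. \<mu> i * (\<integral>\<theta>. \<theta> i / r \<partial>A s))) / d"
  proof -
    define X where "X s = (\<Sum>i<d. \<mu> i * (\<integral>\<theta>. \<theta> i / r \<partial>A s))" for s
    show ?thesis
      unfolding X_def[symmetric] sum_negf[symmetric] sum_divide_distrib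
      using integral_nth unfolding X_def[symmetric] by (intro sum.cong refl) simp
  qed
  ultimately have "((\<Sum>i<d. \<bar>\<mu> i\<bar>) - (\<Sum>s\<in>{1..n} \<rightarrow>\<^sub>E sign_cube d.
      sample_mass d \<mu> {1..n} s * (\<Sum>i<d. \<mu> i * (\<integral>\<theta>. \<theta> i / r \<partial>A s)))) / d \<le> \<alpha>"
    using inf by (simp add: diff_divide_distrib)
  then show ?thesis
    using d by (simp add: field_simps)
qed

section \<open>From correlation to traceability: fresh scores against sample scores\<close>

text \<open>Chernoff's bound for a centred sum with variance proxy at most \<open>d\<close>.\<close>

lemma bias_mass_tail:
  fixes b :: rvec
  assumes \<mu>: "\<And>i. i < d \<Longrightarrow> \<bar>\<mu> i\<bar> \<le> 1" and b: "\<And>i. i < d \<Longrightarrow> \<bar>b i\<bar> \<le> 1"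
    and d: "1 \<le> d" and "0 \<le> \<kappa>"
  shows "(\<Sum>z\<in>sign_cube d. bias_mass d \<mu> z * indicator {z. \<kappa> \<le> (\<Sum>i<d. b i * (z i - \<mu> i))} z)
    \<le> exp (- (\<kappa>\<^sup>2 / (2 * d)))"
proof -
  \<comment> \<open>This value minimises the exponent
    \<open>d * l\<^sup>2 / 2 - l * \<kappa>\<close>.\<close>
  define l where "l = \<kappa> / d"
  have l: "0 \<le> l" using assms by (simp add: l_def)
  have "(\<Sum>z\<in>sign_cube d. bias_mass d \<mu> z * indicator {z. \<kappa> \<le> (\<Sum>i<d. b i * (z i - \<mu> i))} z)
      \<le> (\<Sum>z\<in>sign_cube d. bias_mass d \<mu> z * (exp (- (l * \<kappa>)) * exp (\<Sum>i<d. l * b i * (z i - \<mu> i))))"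
  proof (intro sum_mono mult_left_mono bias_mass_nonneg \<mu>)
    fix z
    have "(\<Sum>i<d. l * b i * (z i - \<mu> i)) = l * (\<Sum>i<d. b i * (z i - \<mu> i))"
      by (simp add: sum_distrib_left mult.assoc)
    then show "indicator {z. \<kappa> \<le> (\<Sum>i<d. b i * (z i - \<mu> i))} z
        \<le> exp (- (l * \<kappa>)) * exp (\<Sum>i<d. l * b i * (z i - \<mu> i))"
      using l by (auto simp: indicator_def exp_add[symmetric] intro: mult_left_mono)
  qed auto
  also have "\<dots> = exp (- (l * \<kappa>)) * (\<Sum>z\<in>sign_cube d. bias_mass d \<mu> z * exp (\<Sum>i<d. l * b i * (z i - \<mu> i)))"
    by (simp add: sum_distrib_left mult_ac)
  also have "\<dots> \<le> exp (- (l * \<kappa>)) * exp ((\<Sum>i<d. (l * b i)\<^sup>2) / 2)"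
    by (intro mult_left_mono bias_mass_mgf[of d \<mu> "\<lambda>i. l * b i"] \<mu>) auto
  also have "\<dots> \<le> exp (- (l * \<kappa>)) * exp (d * l\<^sup>2 / 2)"
  proof -
    have "(l * b i)\<^sup>2 \<le> l\<^sup>2" if "i < d" for i
      using mult_left_mono[of "(b i)\<^sup>2" 1 "l\<^sup>2"] b[OF that] by (simp add: power_mult_distrib abs_square_le_1)
    then have "(\<Sum>i<d. (l * b i)\<^sup>2) \<le> d * l\<^sup>2"
      using sum_bounded_above[of "{..<d}" "\<lambda>i. (l * b i)\<^sup>2" "l\<^sup>2"] by simp
    then show ?thesis by simp
  qed
  also have "\<dots> = exp (- (\<kappa>\<^sup>2 / (2 * d)))"
    unfolding exp_add[symmetric] l_def using d
    by (intro arg_cong[where f=exp]) (simp add: field_simps power2_eq_square)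
  finally show ?thesis .
qed

text \<open>One bias vector, obtained from \<open>fingerprinting\<close>, defines both the data law
  and the score. The hypothesis \<open>small\<close> says that points below the threshold account
  for at most half of the total score \<open>d / (24 * \<alpha>)\<close>.\<close>

lemma cube_learner_traceable:
  assumes learner: "alpha_learner d n \<alpha> (cube_problem d r) A"
    and r: "0 < r" and d: "1 \<le> d" and nd: "n \<le> d" and \<xi>: "0 < \<xi>" "\<xi> < 1"
    and \<alpha>: "0 < \<alpha>" "\<alpha> \<le> 1 / 6" and small: "n * sqrt (2 * d * ln (1 / \<xi>)) \<le> d / (48 * \<alpha>)"
  shows "traceable d n \<xi> (1 / (9216 * \<alpha>\<^sup>2)) (cube_problem d r) A"
proof -
  let ?V = "sign_cube d"
  let ?S = "{1..n} \<rightarrow>\<^sub>E ?V"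
  let ?P = "param_space d (cube_params d r)"
  have A: "A \<in> Pi\<^sub>M {1..n} (\<lambda>_. count_space ?V) \<rightarrow>\<^sub>M prob_algebra ?P"
    using learner by (simp add: alpha_learner_def learning_algorithm_def cube_problem_def)
  \<comment> \<open>The bias range must exceed \<open>3 * \<alpha>\<close> for
    \<open>a / 3 - \<alpha>\<close> to be positive. The factor 4 leaves \<open>\<alpha> / 3\<close>,
    and \<alpha> \<le> 1/6 keeps \<open>a\<close> below 1.\<close>
  define a where "a = 4 * \<alpha>"
  have a: "0 < a" "a < 1" using \<alpha> by (auto simp: a_def)
  define g where "g s i = (\<integral>\<theta>. \<theta> i / r \<partial>A s)" for s i
  have "\<exists>\<mu>. (\<forall>i<d. \<bar>\<mu> i\<bar> \<le> a) \<and>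
    2 / a\<^sup>2 * (d * (a / 3 - \<alpha>))
      \<le> (\<Sum>s\<in>?S. sample_mass d \<mu> {1..n} s *
          (\<Sum>i<d. g s i * (score_weight a (\<mu> i) * (\<Sum>j\<in>{1..n}. s j i - \<mu> i))))"
  proof (rule fingerprinting[OF a])
    fix \<mu> :: rvec assume "\<And>i. i < d \<Longrightarrow> \<bar>\<mu> i\<bar> \<le> a"
    with a have "\<bar>\<mu> i\<bar> \<le> 1" if "i < d" for i using that by force
    from cube_learner_correlation[OF learner r d this]
    show "(\<Sum>i<d. \<bar>\<mu> i\<bar>) - d * \<alpha>
        \<le> (\<Sum>s\<in>?S. sample_mass d \<mu> {1..n} s * (\<Sum>i<d. \<mu> i * g s i))"
      unfolding g_def .
  qed auto
  moreover have "2 / a\<^sup>2 * (d * (a / 3 - \<alpha>)) = d / (24 * \<alpha>)"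
    unfolding a_def using \<alpha> by (simp add: field_simps power2_eq_square)
  ultimately obtain \<mu> where \<mu>a: "\<And>i. i < d \<Longrightarrow> \<bar>\<mu> i\<bar> \<le> a"
    and fp: "d / (24 * \<alpha>) \<le> (\<Sum>s\<in>?S. sample_mass d \<mu> {1..n} s *
          (\<Sum>i<d. g s i * (score_weight a (\<mu> i) * (\<Sum>j\<in>{1..n}. s j i - \<mu> i))))"
    by auto
  have \<mu>: "\<bar>\<mu> i\<bar> \<le> 1" if "i < d" for i using \<mu>a[OF that] a by simp
  define w where "w i = score_weight a (\<mu> i)" for i
  have w: "\<bar>w i\<bar> \<le> 1" if "i < d" for i
    using score_weight_bounds[OF a \<mu>a[OF that]] by (simp add: w_def)
  define \<phi> where "\<phi> \<theta> z = (\<Sum>i<d. \<theta> i / r * w i * (z i - \<mu> i))" for \<theta> z :: rvec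
  \<comment> \<open>The threshold at which the Chernoff bound equals \<xi> exactly.\<close>
  define \<kappa> where "\<kappa> = sqrt (2 * d * ln (1 / \<xi>))"
  have ln: "0 < ln (1 / \<xi>)" using \<xi> by simp
  have \<kappa>: "0 \<le> \<kappa>" using ln by (simp add: \<kappa>_def)
  have \<kappa>_exp: "exp (- (\<kappa>\<^sup>2 / (2 * d))) = \<xi>"
  proof -
    have "\<kappa>\<^sup>2 / (2 * d) = ln (1 / \<xi>)"
      unfolding \<kappa>_def using ln d by (subst real_sqrt_pow2) auto
    then show ?thesis using \<xi> by (simp add: exp_minus)
  qed
  have unit: "\<bar>\<theta> i / r\<bar> \<le> 1" if "\<theta> \<in> cube_params d r" "i < d" for \<theta> i
    using cube_params_nth[OF that] r by simp
  have \<phi>_meas: "(\<lambda>(\<theta>, z). \<phi> \<theta> z) \<in> borel_measurable (?P \<Otimes>\<^sub>M count_space ?V)"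
  proof -
    have [measurable]: "(\<lambda>z. z i) \<in> borel_measurable (count_space ?V)" for i by simp
    show ?thesis unfolding \<phi>_def by measurable
  qed
  let ?T = "\<lambda>\<theta> s. {i \<in> {1..n}. \<kappa> \<le> \<phi> \<theta> (s i)}"
  have \<phi>_meas1: "(\<lambda>\<theta>. \<phi> \<theta> z) \<in> borel_measurable ?P" for z
    unfolding \<phi>_def by measurable
  have \<phi>_meas2: "(\<lambda>(\<theta>, s). \<phi> \<theta> (s j)) \<in> borel_measurable (?P \<Otimes>\<^sub>M Pi\<^sub>M {0..n} (\<lambda>_. bias_measure d \<mu>))"
    if "j \<le> n" for j
  proof -
    have "(\<lambda>(\<theta>, s). (\<theta>, s j)) \<in> ?P \<Otimes>\<^sub>M Pi\<^sub>M {0..n} (\<lambda>_. bias_measure d \<mu>) \<rightarrow>\<^sub>M ?P \<Otimes>\<^sub>M bias_measure d \<mu>"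
      unfolding case_prod_beta
      by (intro measurable_Pair measurable_compose[OF measurable_snd measurable_component_singleton]) (use that in auto)
    moreover have "(\<lambda>(\<theta>, z). \<phi> \<theta> z) \<in> borel_measurable (?P \<Otimes>\<^sub>M bias_measure d \<mu>)"
      using \<phi>_meas by (subst measurable_cong_sets[OF sets_pair_measure_cong[OF refl sets_bias_measure] refl])
    ultimately have "(\<lambda>(\<theta>, z). \<phi> \<theta> z) \<circ> (\<lambda>(\<theta>, s). (\<theta>, s j))
        \<in> borel_measurable (?P \<Otimes>\<^sub>M Pi\<^sub>M {0..n} (\<lambda>_. bias_measure d \<mu>))"
      by (rule measurable_comp)
    then show ?thesis by (simp add: comp_def case_prod_beta)
  qed
  let ?L = "trace_law d n (cube_params d r) A (bias_measure d \<mu>)"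
  have ins: "{0..n} = insert 0 {1..n}" by auto
  have split_fresh: "(\<Sum>s\<in>{0..n} \<rightarrow>\<^sub>E ?V. sample_mass d \<mu> {0..n} s * h (s 0) (restrict s {1..n}))
      = (\<Sum>s\<in>?S. sample_mass d \<mu> {1..n} s * (\<Sum>z\<in>?V. bias_mass d \<mu> z * h z s))" for h
    unfolding ins by (rule sum_sample_mass_insert) auto
  have "measure ?L {(\<theta>, s) \<in> space ?L. \<kappa> \<le> \<phi> \<theta> (s 0)} \<le> \<xi>"
  proof -
    let ?E = "{x. \<kappa> \<le> \<phi> (fst x) (snd x 0)}"
    have E: "{(\<theta>, s) \<in> space ?L. \<kappa> \<le> \<phi> \<theta> (s 0)} = ?E \<inter> space ?L" by auto
    have ind_meas: "(indicator ?E :: _ \<Rightarrow> real) \<in> borel_measurable (?P \<Otimes>\<^sub>M Pi\<^sub>M {0..n} (\<lambda>_. bias_measure d \<mu>))"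
      using \<phi>_meas2[of 0] by (simp add: case_prod_beta)
    have "measure ?L (?E \<inter> space ?L) = (\<integral>x. indicator ?E x \<partial>?L)"
      by simp
    also have "\<dots> = (\<Sum>s\<in>{0..n} \<rightarrow>\<^sub>E ?V. sample_mass d \<mu> {0..n} s *
        (\<integral>\<theta>. indicator {z. \<kappa> \<le> \<phi> \<theta> z} (s 0) \<partial>A (restrict s {1..n})))"
      by (subst integral_trace_law[OF A \<mu> ind_meas, where B=1]) (auto simp: indicator_def)
    also have "\<dots> = (\<Sum>s\<in>?S. sample_mass d \<mu> {1..n} s *
        (\<Sum>z\<in>?V. bias_mass d \<mu> z * (\<integral>\<theta>. indicator {z. \<kappa> \<le> \<phi> \<theta> z} z \<partial>A s)))"
      by (rule split_fresh[where h="\<lambda>z s. \<integral>\<theta>. indicator {z. \<kappa> \<le> \<phi> \<theta> z} z \<partial>A s"])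
    also have "\<dots> \<le> (\<Sum>s\<in>?S. sample_mass d \<mu> {1..n} s * \<xi>)"
    proof (intro sum_mono mult_left_mono sample_mass_nonneg \<mu>)
      fix s assume s: "s \<in> ?S"
      note K = kernel_prob[OF A s]
      interpret prob_space "A s" by (rule K(1))
      have int: "integrable (A s) (\<lambda>\<theta>. indicator {z. \<kappa> \<le> \<phi> \<theta> z} z :: real)" for z
      proof (rule integrable_const_bound[where B=1])
        have "(\<lambda>\<theta>. indicator {\<theta>. \<kappa> \<le> \<phi> \<theta> z} \<theta> :: real) \<in> borel_measurable ?P"
          using \<phi>_meas1[of z] by simp
        then show "(\<lambda>\<theta>. indicator {z. \<kappa> \<le> \<phi> \<theta> z} z :: real) \<in> borel_measurable (A s)"
          by (subst measurable_cong_sets[OF K(2) refl]) (simp add: indicator_def)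
      qed (auto simp: indicator_def)
      \<comment> \<open>The output is fixed first: it is independent of the fresh point, whose score
        is then a centred sum to which \<open>bias_mass_tail\<close> applies.\<close>
      have "(\<Sum>z\<in>?V. bias_mass d \<mu> z * (\<integral>\<theta>. indicator {z. \<kappa> \<le> \<phi> \<theta> z} z \<partial>A s))
          = (\<integral>\<theta>. (\<Sum>z\<in>?V. bias_mass d \<mu> z * indicator {z. \<kappa> \<le> \<phi> \<theta> z} z) \<partial>A s)"
        using int by (subst Bochner_Integration.integral_sum) simp_all
      also have "\<dots> \<le> (\<integral>\<theta>. \<xi> \<partial>A s)"
      proof (rule integral_mono)
        show "integrable (A s) (\<lambda>\<theta>. \<Sum>z\<in>?V. bias_mass d \<mu> z * indicator {z. \<kappa> \<le> \<phi> \<theta> z} z)"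
          using int by (intro Bochner_Integration.integrable_sum integrable_mult_right)
        fix \<theta> assume "\<theta> \<in> space (A s)"
        then have \<theta>: "\<theta> \<in> cube_params d r" by (simp add: K)
        have "\<bar>\<theta> i / r * w i\<bar> \<le> 1" if "i < d" for i
          using mult_mono[OF unit[OF \<theta> that] w[OF that]] by (simp add: abs_mult)
        from bias_mass_tail[OF \<mu> this d \<kappa>] show "(\<Sum>z\<in>?V. bias_mass d \<mu> z * indicator {z. \<kappa> \<le> \<phi> \<theta> z} z) \<le> \<xi>"
          unfolding \<phi>_def \<kappa>_exp .
      qed auto
      also have "\<dots> = \<xi>" by (simp add: prob_space)
      finally show "(\<Sum>z\<in>?V. bias_mass d \<mu> z * (\<integral>\<theta>. indicator {z. \<kappa> \<le> \<phi> \<theta> z} z \<partial>A s)) \<le> \<xi>" .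
    qed auto
    also have "\<dots> = \<xi>"
      by (simp add: sum_distrib_right[symmetric] sum_sample_mass)
    finally show ?thesis unfolding E .
  qed
  moreover have "1 / (9216 * \<alpha>\<^sup>2) \<le> (\<integral>(\<theta>, s). real (card (?T \<theta> s)) \<partial>?L)"
  proof -
    define N where "N = (\<Sum>s\<in>?S. sample_mass d \<mu> {1..n} s * (\<integral>\<theta>. card (?T \<theta> s) \<partial>A s))"
    have card_sum: "real (card (?T \<theta> s)) = (\<Sum>i\<in>{1..n}. indicator {\<theta>. \<kappa> \<le> \<phi> \<theta> (s i)} \<theta>)" for \<theta> s
    proof -
      have "real (card (?T \<theta> s)) = (\<Sum>i\<in>{1..n}. if \<kappa> \<le> \<phi> \<theta> (s i) then 1 else 0)"
        by (simp add: sum.If_cases Int_def)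
      then show ?thesis by (simp add: indicator_def of_bool_def)
    qed
    have card_le: "card (?T \<theta> s) \<le> n" for \<theta> s
    proof -
      have "card (?T \<theta> s) \<le> card {1..n}" by (rule card_mono) auto
      then show ?thesis by simp
    qed
    have count: "(\<integral>(\<theta>, s). real (card (?T \<theta> s)) \<partial>?L) = N"
    proof -
      have meas: "(\<lambda>(\<theta>, s). real (card (?T \<theta> s)))
          \<in> borel_measurable (?P \<Otimes>\<^sub>M Pi\<^sub>M {0..n} (\<lambda>_. bias_measure d \<mu>))"
      proof -
        have "(\<lambda>x. \<Sum>i\<in>{1..n}. indicator {x. \<kappa> \<le> \<phi> (fst x) (snd x i)} x :: real)
            \<in> borel_measurable (?P \<Otimes>\<^sub>M Pi\<^sub>M {0..n} (\<lambda>_. bias_measure d \<mu>))"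
          using \<phi>_meas2 by (intro borel_measurable_sum) (simp add: case_prod_beta)
        then show ?thesis
        proof (rule measurable_cong[THEN iffD1, rotated])
          fix x :: "rvec \<times> (nat \<Rightarrow> rvec)"
          show "(\<Sum>i\<in>{1..n}. indicator {x. \<kappa> \<le> \<phi> (fst x) (snd x i)} x :: real)
              = (case x of (\<theta>, s) \<Rightarrow> real (card (?T \<theta> s)))"
            unfolding case_prod_beta card_sum by (intro sum.cong refl) (simp add: indicator_def)
        qed
      qed
      have "(\<integral>(\<theta>, s). real (card (?T \<theta> s)) \<partial>?L) = (\<Sum>s\<in>{0..n} \<rightarrow>\<^sub>E ?V. sample_mass d \<mu> {0..n} s *
          (\<integral>\<theta>. card (?T \<theta> s) \<partial>A (restrict s {1..n})))"
        by (subst integral_trace_law[OF A \<mu> meas, where B=n]) (use card_le in auto)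
      \<comment> \<open>The count involves only indices in \<open>{1..n}\<close>, so it is unchanged
        when the fresh point is dropped from \<open>s\<close>.\<close>
      also have "\<dots> = (\<Sum>s\<in>{0..n} \<rightarrow>\<^sub>E ?V. sample_mass d \<mu> {0..n} s *
          (\<integral>\<theta>. card (?T \<theta> (restrict s {1..n})) \<partial>A (restrict s {1..n})))"
        by (intro sum.cong refl arg_cong2[where f="(*)"] Bochner_Integration.integral_cong
            arg_cong[where f=real] arg_cong[where f=card]) auto
      also have "\<dots> = (\<Sum>s\<in>?S. sample_mass d \<mu> {1..n} s *
          (\<Sum>z\<in>?V. bias_mass d \<mu> z * (\<integral>\<theta>. card (?T \<theta> s) \<partial>A s)))"
        by (rule split_fresh[where h="\<lambda>_ s. \<integral>\<theta>. card (?T \<theta> s) \<partial>A s"])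
      also have "\<dots> = N"
        unfolding N_def by (simp add: sum_distrib_right[symmetric] sum_bias_mass)
      finally show ?thesis .
    qed
    \<comment> \<open>After removing the low scores, at least \<open>d / (48 * \<alpha>)\<close>
      remains. By \<open>n \<le> d\<close> the error \<open>(n + d) / l\<close> is at most
      \<open>2 * d / l = d / (96 * \<alpha>)\<close>, half of that remainder. The other half must be
      covered by \<open>l * d / 2 * N = 96 * \<alpha> * d * N\<close>.\<close>
    define l where "l = 192 * \<alpha>"
    have l: "0 < l" using \<alpha> by (simp add: l_def)
    obtain W where W: "\<forall>s. \<forall>T\<subseteq>{1..n}. \<forall>x. (\<forall>i<d. \<bar>x i\<bar> \<le> 1) \<longrightarrow>
        (\<Sum>j\<in>T. \<Sum>i<d. x i * w i * (s j i - \<mu> i)) \<le> l * d * card T / 2 + W s"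
      and EW: "(\<Sum>s\<in>?S. sample_mass d \<mu> {1..n} s * W s) \<le> (card {1..n} + d) / l"
      using selected_score_bound[of d \<mu> w "{1..n}" l, OF \<mu> w finite_atLeastAtMost l] by blast
    \<comment> \<open>The traced set and the output both depend on the sample, which is why
      \<open>W\<close> had to be uniform in \<open>T\<close> and \<open>x\<close>. Enlarging the sum
      over untraced points to all \<open>n\<close> points uses 0 \<le> \<kappa>.\<close>
    have pointwise: "(\<Sum>j\<in>{1..n}. \<phi> \<theta> (s j)) \<le> n * \<kappa> + l * d / 2 * card (?T \<theta> s) + W s"
      if \<theta>: "\<theta> \<in> cube_params d r" for \<theta> s
    proof -
      have "(\<Sum>j\<in>{1..n}. \<phi> \<theta> (s j)) = (\<Sum>j\<in>{1..n} - ?T \<theta> s. \<phi> \<theta> (s j)) + (\<Sum>j\<in>?T \<theta> s. \<phi> \<theta> (s j))"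
        by (rule sum.subset_diff) auto
      also have "(\<Sum>j\<in>{1..n} - ?T \<theta> s. \<phi> \<theta> (s j)) \<le> (\<Sum>j\<in>{1..n} - ?T \<theta> s. \<kappa>)"
        by (intro sum_mono) auto
      also have "\<dots> \<le> (\<Sum>j\<in>{1..n}. \<kappa>)"
        using \<kappa> by (intro sum_mono2) auto
      also have "(\<Sum>j\<in>?T \<theta> s. \<phi> \<theta> (s j)) \<le> l * d * card (?T \<theta> s) / 2 + W s"
        unfolding \<phi>_def by (rule W[rule_format, where x="\<lambda>i. \<theta> i / r"]) (use unit[OF \<theta>] in auto)
      finally show ?thesis by simp
    qed
    have mean: "(\<Sum>i<d. g s i * (w i * (\<Sum>j\<in>{1..n}. s j i - \<mu> i)))
        \<le> n * \<kappa> + l * d / 2 * (\<integral>\<theta>. card (?T \<theta> s) \<partial>A s) + W s" if s: "s \<in> ?S" for s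
    proof -
      note K = kernel_prob[OF A s]
      interpret prob_space "A s" by (rule K(1))
      have nth: "integrable (A s) (\<lambda>\<theta>. \<theta> i / r)" if "i < d" for i
        by (rule integrable_const_bound[where B=1])
           (use unit that in \<open>auto intro!: AE_I2 simp: K measurable_cong_sets[OF K(2) refl]\<close>)
      have card: "integrable (A s) (\<lambda>\<theta>. real (card (?T \<theta> s)))"
      proof (rule integrable_const_bound[where B=n])
        have "(\<lambda>\<theta>. \<Sum>i\<in>{1..n}. indicator {\<theta>. \<kappa> \<le> \<phi> \<theta> (s i)} \<theta> :: real) \<in> borel_measurable ?P"
          using \<phi>_meas1 by (intro borel_measurable_sum) simp
        then show "(\<lambda>\<theta>. real (card (?T \<theta> s))) \<in> borel_measurable (A s)"
          unfolding card_sum by (subst measurable_cong_sets[OF K(2) refl])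
      qed (use card_le in simp)
      have eq: "(\<Sum>j\<in>{1..n}. \<phi> \<theta> (s j)) = (\<Sum>i<d. \<theta> i / r * (w i * (\<Sum>j\<in>{1..n}. s j i - \<mu> i)))" for \<theta>
        unfolding \<phi>_def by (subst sum.swap) (simp add: sum_distrib_left mult.assoc)
      have int: "integrable (A s) (\<lambda>\<theta>. \<theta> i / r * c)" if "i < d" for i c
        using nth[OF that] by (rule integrable_mult_left)
      have "(\<Sum>i<d. g s i * (w i * (\<Sum>j\<in>{1..n}. s j i - \<mu> i)))
          = (\<integral>\<theta>. (\<Sum>i<d. \<theta> i / r * (w i * (\<Sum>j\<in>{1..n}. s j i - \<mu> i))) \<partial>A s)"
        unfolding g_def using int
        by (subst Bochner_Integration.integral_sum) (simp_all del: times_divide_eq_left)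
      also have "\<dots> \<le> (\<integral>\<theta>. n * \<kappa> + l * d / 2 * card (?T \<theta> s) + W s \<partial>A s)"
      proof (rule integral_mono)
        show "integrable (A s) (\<lambda>\<theta>. \<Sum>i<d. \<theta> i / r * (w i * (\<Sum>j\<in>{1..n}. s j i - \<mu> i)))"
          using int by (intro Bochner_Integration.integrable_sum) auto
        show "integrable (A s) (\<lambda>\<theta>. n * \<kappa> + l * d / 2 * card (?T \<theta> s) + W s)"
          using card by (intro Bochner_Integration.integrable_add integrable_mult_right) auto
        fix \<theta> assume "\<theta> \<in> space (A s)"
        then show "(\<Sum>i<d. \<theta> i / r * (w i * (\<Sum>j\<in>{1..n}. s j i - \<mu> i)))
            \<le> n * \<kappa> + l * d / 2 * card (?T \<theta> s) + W s"
          using pointwise unfolding K(3) space_param_space_cube eq[symmetric] by blast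
      qed
      also have "\<dots> = n * \<kappa> + l * d / 2 * (\<integral>\<theta>. card (?T \<theta> s) \<partial>A s) + W s"
        using card by (simp add: prob_space)
      finally show ?thesis .
    qed
    have "d / (24 * \<alpha>) \<le> (\<Sum>s\<in>?S. sample_mass d \<mu> {1..n} s *
        (n * \<kappa> + l * d / 2 * (\<integral>\<theta>. card (?T \<theta> s) \<partial>A s) + W s))"
      by (rule order_trans[OF fp], unfold w_def[symmetric], intro sum_mono mult_left_mono mean)
         (use \<mu> in \<open>auto intro: sample_mass_nonneg\<close>)
    also have "\<dots> = n * \<kappa> * (\<Sum>s\<in>?S. sample_mass d \<mu> {1..n} s) + l * d / 2 * N
        + (\<Sum>s\<in>?S. sample_mass d \<mu> {1..n} s * W s)"
      unfolding N_def sum_distrib_left sum.distrib[symmetric]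
      by (intro sum.cong refl) (simp add: algebra_simps)
    also have "\<dots> \<le> d / (48 * \<alpha>) + l * d / 2 * N + (n + d) / l"
      using small EW unfolding \<kappa>_def by (simp add: sum_sample_mass)
    also have "\<dots> \<le> d / (48 * \<alpha>) + l * d / 2 * N + 2 * d / l"
      using nd l by (simp add: divide_right_mono)
    finally have "d * (1 / (96 * \<alpha>)) \<le> d * (96 * \<alpha> * N)"
      unfolding l_def using \<alpha> by (simp add: field_simps)
    then have "1 / (96 * \<alpha>) \<le> 96 * \<alpha> * N"
      using d by (simp add: mult_le_cancel_left_pos del: times_divide_eq_right)
    then show ?thesis
      unfolding count using \<alpha> by (simp add: field_simps power2_eq_square)
  qed
  moreover have "tracer d (cube_problem d r) (\<lambda>(\<theta>, z). \<phi> \<theta> z) (bias_measure d \<mu>)"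
    using \<phi>_meas bias_measure_in_prob_measures[of d \<mu>, OF \<mu>]
    unfolding tracer_def cube_problem_def by simp
  ultimately show ?thesis
    unfolding traceable_def cube_problem_def prod.case
    by (intro exI[of _ "\<lambda>(\<theta>, z). \<phi> \<theta> z"] exI[of _ "bias_measure d \<mu>"] exI[of _ \<kappa>]) simp
qed


section \<open>Choice of the constants and reduction to the cube problem\<close>

theorem theorem2p5:
  shows "\<exists>c c' :: real. c > 0 \<and> c' > 0 \<and>
    (\<forall>(p :: real) (d :: nat) (n :: nat) (\<xi> :: real) (\<alpha> :: real).
       1 \<le> p \<and> p < 2 \<and> 1 \<le> d \<and> 1 \<le> n \<and> 0 < \<xi> \<and> \<xi> < 1 / exp 1 \<and> 0 < \<alpha> \<and>
       c / sqrt (real n) \<le> \<alpha> \<and>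
       \<alpha> \<le> min (c * sqrt (real d / ((real n)\<^sup>2 * ln (1 / \<xi>)))) (1 / 6) \<longrightarrow>
       (\<exists>P :: (nat \<Rightarrow> real) sco. P \<in> lp_sco_problems p d \<and>
          (\<forall>A. alpha_learner d n \<alpha> P A \<longrightarrow>
             (\<exists>m :: real. m \<ge> c' * \<alpha> powr (- 2) \<and> traceable d n \<xi> m P A))))"
proof (rule exI[of _ "1 / 96"], rule exI[of _ "1 / 9216"], intro conjI allI impI)
  fix p \<xi> \<alpha> :: real and d n :: nat
  assume "1 \<le> p \<and> p < 2 \<and> 1 \<le> d \<and> 1 \<le> n \<and> 0 < \<xi> \<and> \<xi> < 1 / exp 1 \<and> 0 < \<alpha> \<and>
    1 / 96 / sqrt (real n) \<le> \<alpha> \<and>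
    \<alpha> \<le> min (1 / 96 * sqrt (real d / ((real n)\<^sup>2 * ln (1 / \<xi>)))) (1 / 6)"
  then have p: "1 \<le> p" and d: "1 \<le> d" and n: "1 \<le> n" and \<xi>: "0 < \<xi>" "\<xi> < 1 / exp 1" and \<alpha>: "0 < \<alpha>" "\<alpha> \<le> 1 / 6"
    and lower: "1 / 96 / sqrt n \<le> \<alpha>" and upper: "\<alpha> \<le> 1 / 96 * sqrt (d / (n\<^sup>2 * ln (1 / \<xi>)))"
    by auto
  define L where "L = ln (1 / \<xi>)"
  have "exp 1 < 1 / \<xi>" using \<xi> by (simp add: field_simps)
  then have L: "1 < L" unfolding L_def using \<xi> ln_less_cancel_iff[of "exp 1" "1 / \<xi>"] by simp
  have \<xi>1: "\<xi> < 1" using \<xi> by (rule_tac less_trans[OF \<xi>(2)]) simp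
  \<comment> \<open>The same constant stands in the lower and the upper bound on \<alpha>, so it
    cancels and leaves \<open>n * L \<le> d\<close>. With \<open>L > 1\<close>, from \<xi> < 1/e,
    this gives \<open>n \<le> d\<close>.\<close>
  have "1 / sqrt n \<le> sqrt (d / (n\<^sup>2 * L))"
    using lower upper unfolding L_def by simp
  then have "sqrt (1 / n) \<le> sqrt (d / (n\<^sup>2 * L))"
    by (simp add: real_sqrt_divide)
  then have "1 / n \<le> d / (n\<^sup>2 * L)" by (simp only: real_sqrt_le_iff)
  then have "n * L \<le> d" using n L by (simp add: field_simps power2_eq_square)
  moreover have "real n * 1 \<le> n * L" using L by (intro mult_left_mono) auto
  ultimately have nd: "n \<le> d" by linarith
  \<comment> \<open>The constant 1/96 is chosen for \<open>small\<close>: multiplying by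
    \<open>sqrt d\<close> gives \<open>d / (96 * \<alpha>)\<close>, and \<open>sqrt 2\<close>,
    rounded up to 2, turns this into \<open>d / (48 * \<alpha>)\<close>.\<close>
  have "96 * \<alpha> \<le> sqrt d / (n * sqrt L)"
  proof -
    have "96 * \<alpha> \<le> sqrt (d / (n\<^sup>2 * L))"
      using upper unfolding L_def by simp
    then show ?thesis by (simp add: real_sqrt_divide real_sqrt_mult)
  qed
  then have *: "96 * \<alpha> * (n * sqrt L) \<le> sqrt d"
    using n L by (simp add: pos_le_divide_eq)
  have "sqrt 2 \<le> 2" using real_sqrt_le_mono[of 2 4] by simp
  have "n * sqrt (2 * d * L) = sqrt 2 * (sqrt d * (n * sqrt L))"
    by (simp add: real_sqrt_mult)
  also have "\<dots> \<le> 2 * (sqrt d * (n * sqrt L))"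
    using L \<open>sqrt 2 \<le> 2\<close> by (intro mult_right_mono) auto
  also have "\<dots> \<le> d / (48 * \<alpha>)"
  proof -
    have "sqrt d * (96 * \<alpha> * (n * sqrt L)) \<le> sqrt d * sqrt d"
      by (rule mult_left_mono[OF *]) simp
    then show ?thesis using \<alpha> by (simp add: field_simps)
  qed
  finally have small: "n * sqrt (2 * d * ln (1 / \<xi>)) \<le> d / (48 * \<alpha>)" unfolding L_def .
  let ?P = "cube_problem d (d powr (-1 / p))"
  show "\<exists>P :: (nat \<Rightarrow> real) sco. P \<in> lp_sco_problems p d \<and>
          (\<forall>A. alpha_learner d n \<alpha> P A \<longrightarrow>
             (\<exists>m :: real. m \<ge> 1 / 9216 * \<alpha> powr (- 2) \<and> traceable d n \<xi> m P A))"
  proof (intro exI[of _ ?P] conjI allI impI)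
    show "?P \<in> lp_sco_problems p d"
      using p d by (rule cube_problem_in_lp_sco_problems)
    fix A assume "alpha_learner d n \<alpha> ?P A"
    then have "traceable d n \<xi> (1 / (9216 * \<alpha>\<^sup>2)) ?P A"
      by (rule cube_learner_traceable) (use d nd \<xi> \<xi>1 \<alpha> small in auto)
    moreover have "1 / 9216 * \<alpha> powr (- 2) = 1 / (9216 * \<alpha>\<^sup>2)"
      unfolding powr_minus_divide using \<alpha> by simp
    ultimately show "\<exists>m. m \<ge> 1 / 9216 * \<alpha> powr (- 2) \<and> traceable d n \<xi> m ?P A"
      by (intro exI[of _ "1 / (9216 * \<alpha>\<^sup>2)"]) simp
  qed
qed auto

end
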